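(* Suppose we have an algorithm which takes as input a sequence of (formal) cells $\sigma_1,\dots,\sigma_n$ and their boundaries $\partial\sigma_1,\dots,\partial\sigma_n$ and produces as output the persistent absolute homology of $\sigma_1\cup\dots\cup\sigma_n$, i.e. the persistence module $\mathrm{H}(\mathbb{C},\partial)$. Let $\mathbb{X}=\sigma_1\cup\dots\cup\sigma_n$ be a filtered cell complex, and let $\tau_i=\sigma^*_{n+1-i}$, $1\le i\le n$. Then the same algorithm applied to the sequence of formal cells $\tau_1,\dots,\tau_n$ and coboundaries $\delta\tau_1,\dots,\delta\tau_n$ computes the persistent relative cohomology $\mathrm{H}^*(X_\infty,\mathbb{X})$ of $\mathbb{X}$ (up to reversing the indexing, index $i$ of the output corresponding to index $n-i$ of $\mathrm{H}^*(X_\infty,\mathbb{X})$).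
   Context: Fix a field $\mathbf{k}$ of coefficients. A filtered cell complex $\mathbb{X}: X_1\subset\dots\subset X_n=X_\infty$ starts with a vertex $X_1=\sigma_1$ and satisfies $X_i=X_{i-1}\cup\sigma_i$ with a single cell $\sigma_i$ added at each step; $X_0=\emptyset$. The homological grading is suppressed (total homology is meant). Input data: a sequence of formal cells $\sigma_1,\dots,\sigma_n$ with boundaries is a basis $\sigma_1,\dots,\sigma_n$ of a $\mathbf{k}$-vector space $C_n$ together with $\partial\sigma_j=\sum_{i<j}D_{ij}\sigma_i$ such that $\partial^2=0$; equivalently a strictly upper-triangular matrix $D$ over $\mathbf{k}$ with $D^2=0$. A filtered cell complex gives such data via its cellular boundary map. Set $C_i=\langle\sigma_1,\dots,\sigma_i\rangle$, with boundary $\partial_i=\partial|_{C_i}$, and $\mathbb{C}: C_1\to C_2\to\dots\to C_n$ (inclusions). The persistent absolute homology is the persistence module (sequence of vector spaces and linear maps, considered up to isomorphism) $$\mathrm{H}(\mathbb{C},\partial):\ \mathrm{Ker}(\partial_1)/\mathrm{Im}(\partial_1)\to\dots\to\mathrm{Ker}(\partial_n)/\mathrm{Im}(\partial_n),$$ indexed by $1,\dots,n$. Dual data: $\sigma_1^*,\dots,\sigma_n^*$ is the basis of $C_n^*=\mathrm{Hom}(C_n,\mathbf{k})$ dual to $\sigma_1,\dots,\sigma_n$, and $\delta=\partial^*$ is the adjoint of $\partial$. With $\tau_i=\sigma^*_{n+1-i}$ one has $\delta\tau_j=\sum_{i<j}D^\perp_{ij}\tau_i$ with $D^\perp_{ij}=D_{n+1-j,\,n+1-i}$.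 The persistent relative cohomology $\mathrm{H}^*(X_\infty,\mathbb{X})$ is the homology, with respect to the coboundaries induced by $\delta$, of $$(C_n/\mathbb{C})^*:\ C_n^*\leftarrow(C_n/C_1)^*\leftarrow\dots\leftarrow(C_n/C_{n-1})^*,$$ indexed by $0,\dots,n-1$; that is, $\mathrm{H}^*(X_n)\leftarrow \mathrm{H}^*(X_n,X_1)\leftarrow\dots\leftarrow \mathrm{H}^*(X_n,X_{n-1})$. Index transcription: an interval $[p,q-1]$ of the output for $\tau_i,\delta\tau_i$ is read as the interval $[n+1-q,n-p]$ of $\mathrm{H}^*(X_\infty,\mathbb{X})$. *)

theory Defs
  imports "HOL-Algebra.AbelCoset" "Jordan_Normal_Form.Missing_VectorSpace" "HOL-Library.Multiset"
begin

section \<open>Quotients and duals of vector spaces\<close>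

definition quot_space :: "('k, 'v, 'm) module_scheme \<Rightarrow> 'v set \<Rightarrow> ('k, 'v set) module" where
  "quot_space V W =
    \<lparr>carrier = a_rcosets\<^bsub>V\<^esub> W, mult = (\<lambda>_ _. W), one = W, zero = W,
     add = (\<lambda>X Y. X <+>\<^bsub>V\<^esub> Y), smult = (\<lambda>a X. \<Union>x\<in>X. W +>\<^bsub>V\<^esub> (a \<odot>\<^bsub>V\<^esub> x))\<rparr>"

text \<open>The map on cosets induced by \<open>f\<close>, with values in the quotient of \<open>V\<close> by \<open>W\<close>. Whenever \<open>f\<close> is
  compatible with the two subspaces, all members of the union are one and the same coset.\<close>

definition coset_map :: "('k, 'w, 'm) module_scheme \<Rightarrow> 'w set \<Rightarrow> ('v \<Rightarrow> 'w) \<Rightarrow> 'v set \<Rightarrow> 'w set" where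
  "coset_map V W f X = (\<Union>x\<in>X. W +>\<^bsub>V\<^esub> f x)"

text \<open>Functionals are taken to be undefined outside \<open>carrier V\<close>, so that equality in the dual space
  is equality in HOL; the operations are the pointwise ones of \<^const>\<open>ring.func_space\<close>.\<close>

definition dual_space ::
    "('k, 'r) ring_scheme \<Rightarrow> ('k, 'v, 'm) module_scheme \<Rightarrow> ('k, 'v \<Rightarrow> 'k) module" where
  "dual_space K V = (ring.func_space K (carrier V))
    \<lparr>carrier := {f \<in> carrier V \<rightarrow>\<^sub>E carrier K.
       (\<forall>x\<in>carrier V. \<forall>y\<in>carrier V. f (x \<oplus>\<^bsub>V\<^esub> y) = f x \<oplus>\<^bsub>K\<^esub> f y) \<and>
       (\<forall>a\<in>carrier K. \<forall>x\<in>carrier V. f (a \<odot>\<^bsub>V\<^esub> x) = a \<otimes>\<^bsub>K\<^esub> f x)}\<rparr>"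

text \<open>The adjoint of a linear map \<open>f\<close> with domain \<open>V\<close>.\<close>

definition dual_map :: "('k, 'v, 'm) module_scheme \<Rightarrow> ('v \<Rightarrow> 'w) \<Rightarrow> ('w \<Rightarrow> 'k) \<Rightarrow> 'v \<Rightarrow> 'k" where
  "dual_map V f \<phi> = (\<lambda>x\<in>carrier V. \<phi> (f x))"

definition dual_basis ::
    "('k, 'r) ring_scheme \<Rightarrow> ('k, 'v, 'm) module_scheme \<Rightarrow> nat \<Rightarrow> (nat \<Rightarrow> 'v) \<Rightarrow> nat \<Rightarrow> 'v \<Rightarrow> 'k" where
  "dual_basis K V n \<sigma> i = (THE f. f \<in> carrier (dual_space K V) \<and>
      (\<forall>j\<in>{1..n}. f (\<sigma> j) = (if j = i then \<one>\<^bsub>K\<^esub> else \<zero>\<^bsub>K\<^esub>)))"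

text \<open>Total (ungraded) homology of a vector space with a square-zero endomorphism.\<close>

definition homology :: "('k, 'v, 'm) module_scheme \<Rightarrow> ('v \<Rightarrow> 'v) \<Rightarrow> ('k, 'v set) module" where
  "homology V d =
    quot_space (V\<lparr>carrier := {x \<in> carrier V. d x = \<zero>\<^bsub>V\<^esub>}\<rparr>) (d ` carrier V)"


section \<open>Persistence modules\<close>

text \<open>A persistence module over an index set \<open>I\<close> with arrows \<open>E\<close>: the values of \<open>space\<close> outside \<open>I\<close>,
  and of \<open>arrow i j\<close> for \<open>(i, j)\<close> outside \<open>E\<close> or off the carrier of \<open>space i\<close>, are irrelevant.\<close>

record ('k, 'v) pmod =
  space :: "nat \<Rightarrow> ('k, 'v) module"
  arrow :: "nat \<Rightarrow> nat \<Rightarrow> 'v \<Rightarrow> 'v"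

definition forward :: "nat set \<Rightarrow> (nat \<times> nat) set" where
  "forward I = {(i, j). i \<in> I \<and> j \<in> I \<and> j = Suc i}"

definition backward :: "nat set \<Rightarrow> (nat \<times> nat) set" where
  "backward I = {(i, j). i \<in> I \<and> j \<in> I \<and> i = Suc j}"

definition persistence_module ::
    "('k, 'r) ring_scheme \<Rightarrow> nat set \<Rightarrow> (nat \<times> nat) set \<Rightarrow> ('k, 'v) pmod \<Rightarrow> bool" where
  "persistence_module K I E P \<longleftrightarrow>
     (\<forall>i\<in>I. vectorspace K (space P i)) \<and>
     (\<forall>(i, j)\<in>E. arrow P i j \<in> module_hom K (space P i) (space P j))"

definition pmod_iso ::
    "('k, 'r) ring_scheme \<Rightarrow> nat set \<Rightarrow> (nat \<times> nat) set \<Rightarrow> ('k, 'v) pmod \<Rightarrow> ('k, 'w) pmod \<Rightarrow> bool" where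
  "pmod_iso K I E P Q \<longleftrightarrow>
     (\<exists>\<phi>. (\<forall>i\<in>I. \<phi> i \<in> module_hom K (space P i) (space Q i) \<and>
              bij_betw (\<phi> i) (carrier (space P i)) (carrier (space Q i))) \<and>
          (\<forall>(i, j)\<in>E. \<forall>x\<in>carrier (space P i). \<phi> j (arrow P i j x) = arrow Q i j (\<phi> i x)))"

definition reindex :: "(nat \<Rightarrow> nat) \<Rightarrow> ('k, 'v) pmod \<Rightarrow> ('k, 'v) pmod" where
  "reindex r P = \<lparr>space = (\<lambda>i. space P (r i)), arrow = (\<lambda>i j. arrow P (r i) (r j))\<rparr>"

text \<open>A pair \<open>(a, b)\<close> stands for the closed interval from \<open>a\<close> to \<open>b\<close>. The elements of \<open>bars_at M i\<close>
  are the members of \<open>M\<close> that contain \<open>i\<close>, tagged by \<open>k\<close> according to multiplicity.\<close>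

definition bars_at :: "(nat \<times> nat) multiset \<Rightarrow> nat \<Rightarrow> ((nat \<times> nat) \<times> nat) set" where
  "bars_at M i = {((a, b), k). k < count M (a, b) \<and> a \<le> i \<and> i \<le> b}"

text \<open>The direct sum of the interval modules of \<open>M\<close>: each arrow is the identity on those summands
  that are nonzero at both its ends.\<close>

definition interval_sum ::
    "('k, 'r) ring_scheme \<Rightarrow> (nat \<times> nat) multiset \<Rightarrow> ('k, (nat \<times> nat) \<times> nat \<Rightarrow> 'k) pmod" where
  "interval_sum K M =
    \<lparr>space = (\<lambda>i. ring.func_space K (bars_at M i)),
     arrow = (\<lambda>i j v. \<lambda>x\<in>bars_at M j. if x \<in> bars_at M i then v x else \<zero>\<^bsub>K\<^esub>)\<rparr>"

definition has_barcode ::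
    "('k, 'r) ring_scheme \<Rightarrow> nat set \<Rightarrow> (nat \<times> nat) set \<Rightarrow> ('k, 'v) pmod \<Rightarrow> (nat \<times> nat) multiset \<Rightarrow> bool"
  where
  "has_barcode K I E P M \<longleftrightarrow>
     (\<forall>(a, b)\<in>set_mset M. a \<le> b \<and> {a..b} \<subseteq> I) \<and> pmod_iso K I E P (interval_sum K M)"


section \<open>Formal cells, persistent homology and relative cohomology\<close>

definition strictly_upper :: "('k, 'r) ring_scheme \<Rightarrow> nat \<Rightarrow> (nat \<Rightarrow> nat \<Rightarrow> 'k) \<Rightarrow> bool" where
  "strictly_upper K n D \<longleftrightarrow>
     (\<forall>i\<in>{1..n}. \<forall>j\<in>{1..n}. D i j \<in> carrier K \<and> (j \<le> i \<longrightarrow> D i j = \<zero>\<^bsub>K\<^esub>))"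

definition formal_cells ::
    "('k, 'r) ring_scheme \<Rightarrow> ('k, 'v, 'm) module_scheme \<Rightarrow> nat \<Rightarrow> (nat \<Rightarrow> 'v) \<Rightarrow> ('v \<Rightarrow> 'v) \<Rightarrow>
     (nat \<Rightarrow> nat \<Rightarrow> 'k) \<Rightarrow> bool" where
  "formal_cells K V n \<sigma> d D \<longleftrightarrow>
     vectorspace K V \<and> inj_on \<sigma> {1..n} \<and> vectorspace.basis K V (\<sigma> ` {1..n}) \<and>
     d \<in> module_hom K V V \<and> (\<forall>x\<in>carrier V. d (d x) = \<zero>\<^bsub>V\<^esub>) \<and>
     strictly_upper K n D \<and>
     (\<forall>j\<in>{1..n}. d (\<sigma> j) = (\<Oplus>\<^bsub>V\<^esub>i\<in>{1..<j}. D i j \<odot>\<^bsub>V\<^esub> \<sigma> i))"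

definition cell_span ::
    "('k, 'r) ring_scheme \<Rightarrow> ('k, 'v, 'm) module_scheme \<Rightarrow> (nat \<Rightarrow> 'v) \<Rightarrow> nat \<Rightarrow> 'v set" where
  "cell_span K V \<sigma> i = module.span K V (\<sigma> ` {1..i})"

text \<open>The arrows are induced by the inclusions of the spans.\<close>

definition persistent_homology ::
    "('k, 'r) ring_scheme \<Rightarrow> ('k, 'v) module \<Rightarrow> (nat \<Rightarrow> 'v) \<Rightarrow> ('v \<Rightarrow> 'v) \<Rightarrow> ('k, 'v set) pmod" where
  "persistent_homology K V \<sigma> d =
    \<lparr>space = (\<lambda>i. homology (V\<lparr>carrier := cell_span K V \<sigma> i\<rparr>) d),
     arrow = (\<lambda>i j. coset_map V (d ` cell_span K V \<sigma> j) (\<lambda>x. x))\<rparr>"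

definition rel_cochains ::
    "('k, 'r) ring_scheme \<Rightarrow> ('k, 'v) module \<Rightarrow> (nat \<Rightarrow> 'v) \<Rightarrow> nat \<Rightarrow> ('k, 'v set \<Rightarrow> 'k) module" where
  "rel_cochains K V \<sigma> i = dual_space K (quot_space V (cell_span K V \<sigma> i))"

text \<open>The coboundary induced by the adjoint of \<open>d\<close>, that is, the adjoint of the map that \<open>d\<close> induces
  on the quotient.\<close>

definition rel_coboundary ::
    "('k, 'r) ring_scheme \<Rightarrow> ('k, 'v) module \<Rightarrow> (nat \<Rightarrow> 'v) \<Rightarrow> ('v \<Rightarrow> 'v) \<Rightarrow> nat \<Rightarrow>
     ('v set \<Rightarrow> 'k) \<Rightarrow> 'v set \<Rightarrow> 'k" where
  "rel_coboundary K V \<sigma> d i =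
     dual_map (quot_space V (cell_span K V \<sigma> i)) (coset_map V (cell_span K V \<sigma> i) d)"

text \<open>The arrow from \<open>j\<close> to \<open>i\<close>, where \<open>i \<le> j\<close>, is induced by the adjoint of the projection from the
  quotient by the \<open>i\<close>-th span to the quotient by the \<open>j\<close>-th. The index 0 gives the absolute
  cohomology, as the 0-th span is zero.\<close>

definition relative_cohomology ::
    "('k, 'r) ring_scheme \<Rightarrow> ('k, 'v) module \<Rightarrow> (nat \<Rightarrow> 'v) \<Rightarrow> ('v \<Rightarrow> 'v) \<Rightarrow>
     ('k, ('v set \<Rightarrow> 'k) set) pmod" where
  "relative_cohomology K V \<sigma> d =
    \<lparr>space = (\<lambda>i. homology (rel_cochains K V \<sigma> i) (rel_coboundary K V \<sigma> d i)),
     arrow = (\<lambda>j i. coset_map (rel_cochains K V \<sigma> i)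
        (rel_coboundary K V \<sigma> d i ` carrier (rel_cochains K V \<sigma> i))
        (dual_map (quot_space V (cell_span K V \<sigma> i))
           (coset_map V (cell_span K V \<sigma> j) (\<lambda>x. x))))\<rparr>"

definition dual_cells ::
    "('k, 'r) ring_scheme \<Rightarrow> ('k, 'v, 'm) module_scheme \<Rightarrow> nat \<Rightarrow> (nat \<Rightarrow> 'v) \<Rightarrow> nat \<Rightarrow> 'v \<Rightarrow> 'k" where
  "dual_cells K V n \<sigma> i = dual_basis K V n \<sigma> (n + 1 - i)"

definition perp :: "nat \<Rightarrow> (nat \<Rightarrow> nat \<Rightarrow> 'k) \<Rightarrow> nat \<Rightarrow> nat \<Rightarrow> 'k" where
  "perp n D i j = D (n + 1 - j) (n + 1 - i)"


section \<open>Algorithms for persistent homology\<close>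

definition boundary_matrix :: "('k, 'r) ring_scheme \<Rightarrow> nat \<Rightarrow> (nat \<Rightarrow> nat \<Rightarrow> 'k) \<Rightarrow> bool" where
  "boundary_matrix K n D \<longleftrightarrow> strictly_upper K n D \<and>
     (\<forall>i\<in>{1..n}. \<forall>k\<in>{1..n}. (\<Oplus>\<^bsub>K\<^esub>j\<in>{1..n}. D i j \<otimes>\<^bsub>K\<^esub> D j k) = \<zero>\<^bsub>K\<^esub>)"

definition unit_cell :: "('k, 'r) ring_scheme \<Rightarrow> nat \<Rightarrow> nat \<Rightarrow> nat \<Rightarrow> 'k" where
  "unit_cell K n j = (\<lambda>i\<in>{1..n}. if i = j then \<one>\<^bsub>K\<^esub> else \<zero>\<^bsub>K\<^esub>)"

definition matrix_map ::
    "('k, 'r) ring_scheme \<Rightarrow> nat \<Rightarrow> (nat \<Rightarrow> nat \<Rightarrow> 'k) \<Rightarrow> (nat \<Rightarrow> 'k) \<Rightarrow> nat \<Rightarrow> 'k" where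
  "matrix_map K n D v = (\<lambda>i\<in>{1..n}. \<Oplus>\<^bsub>K\<^esub>j\<in>{1..n}. D i j \<otimes>\<^bsub>K\<^esub> v j)"

text \<open>An algorithm receives the cells only formally, that is, their number and the coefficients of
  their boundaries; the formal cells are then the unit vectors of the coordinate space. Its output
  is specified only up to isomorphism, so it may live in any type.\<close>

definition computes_persistent_homology ::
    "('k, 'r) ring_scheme \<Rightarrow> (nat \<Rightarrow> (nat \<Rightarrow> nat \<Rightarrow> 'k) \<Rightarrow> ('k, 'w) pmod) \<Rightarrow> bool" where
  "computes_persistent_homology K A \<longleftrightarrow>
     (\<forall>n D. 1 \<le> n \<and> boundary_matrix K n D \<longrightarrow>
        persistence_module K {1..n} (forward {1..n}) (A n D) \<and>
        pmod_iso K {1..n} (forward {1..n}) (A n D)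
          (persistent_homology K (ring.func_space K {1..n}) (unit_cell K n) (matrix_map K n D)))"

end

theory Submission
  imports Defs
begin

text \<open>A relative cochain modulo \<open>C\<^sub>m\<close>, the span of \<open>\<sigma>\<^sub>1, \<dots>, \<sigma>\<^sub>m\<close>, is a functional that vanishes
  on \<open>C\<^sub>m\<close>. Listing its values on the cells in reverse order identifies the dual of \<open>C\<^sub>n / C\<^sub>m\<close> with
  the span of the first \<open>n - m\<close> unit vectors, turns the coboundary into the matrix \<open>D\<close> reflected in
  its antidiagonal, and turns restriction along \<open>C\<^sub>n / C\<^sub>i \<rightarrow> C\<^sub>n / C\<^sub>j\<close> into inclusion. So relative
  cohomology is, up to reversing the index, the persistent homology that the algorithm
  is specified to compute for the reflected matrix.\<close>

section \<open>Isomorphisms of persistence modules\<close>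

text \<open>Transposing \<open>D\<close> alone would give a strictly lower triangular matrix.
  Reversing the order of the cells makes it strictly upper again, as the algorithm demands, and at
  the same time makes the annihilator of \<open>C m\<close> an initial span. The obstacle is that
  inverting a \<open>pmod_iso\<close> takes a source that is known to be a persistence module. This
  is known for the output of the algorithm, but it is not established for the homology on either
  side of the comparison. So inversion happens either at that output or one level lower, on chains,
  where cochains and coordinate vectors do form modules. Classes are compared by direct images of
  cosets, which need no representatives, and linear isomorphisms are stated for bare records. The
  barcode clause takes a second reversal, a reflection of the interval modules themselves.\<close>

lemma module_homI:
  assumes "f \<in> carrier V \<rightarrow> carrier W"
    and "\<And>x y. x \<in> carrier V \<Longrightarrow> y \<in> carrier V \<Longrightarrow> f (x \<oplus>\<^bsub>V\<^esub> y) = f x \<oplus>\<^bsub>W\<^esub> f y"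
    and "\<And>a x. a \<in> carrier K \<Longrightarrow> x \<in> carrier V \<Longrightarrow> f (a \<odot>\<^bsub>V\<^esub> x) = a \<odot>\<^bsub>W\<^esub> f x"
  shows "f \<in> module_hom K V W"
  using assms by (simp add: module_hom_def)

lemma module_hom_comp:
  assumes f: "f \<in> module_hom K U V" and g: "g \<in> module_hom K V W"
  shows "(\<lambda>x. g (f x)) \<in> module_hom K U W"
proof (rule module_homI)
  have fc: "f x \<in> carrier V" if "x \<in> carrier U" for x
    using module_hom_closed[OF f] that by auto
  show "(\<lambda>x. g (f x)) \<in> carrier U \<rightarrow> carrier W"
    using module_hom_closed[OF f] module_hom_closed[OF g] by fastforce
  show "g (f (x \<oplus>\<^bsub>U\<^esub> y)) = g (f x) \<oplus>\<^bsub>W\<^esub> g (f y)" if "x \<in> carrier U" "y \<in> carrier U" for x y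
    using that by (simp add: module_hom_add[OF f] module_hom_add[OF g] fc)
  show "g (f (a \<odot>\<^bsub>U\<^esub> x)) = a \<odot>\<^bsub>W\<^esub> g (f x)" if "a \<in> carrier K" "x \<in> carrier U" for a x
    using that by (simp add: module_hom_smult[OF f] module_hom_smult[OF g] fc)
qed

text \<open>A value of the inverse is certified by applying \<open>f\<close> to the candidate, so
  sums and multiples of preimages must stay in \<open>V\<close>; this is where
  \<open>module K V\<close> enters.\<close>

lemma module_hom_inv_into:
  assumes V: "module K V" and f: "f \<in> module_hom K V W"
    and bij: "bij_betw f (carrier V) (carrier W)"
  shows "inv_into (carrier V) f \<in> module_hom K W V"
proof -
  interpret module K V by (fact V)
  let ?g = "inv_into (carrier V) f"
  have g: "?g y \<in> carrier V" "f (?g y) = y" if "y \<in> carrier W" for y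
    using bij that by (auto simp: bij_betw_def intro: inv_into_into f_inv_into_f)
  have g_eq: "?g y = x" if "x \<in> carrier V" "f x = y" for x y
    using bij that by (auto simp: bij_betw_def)
  show ?thesis
  proof (rule module_homI)
    show "?g \<in> carrier W \<rightarrow> carrier V" using g by blast
  qed (auto intro!: g_eq simp: g module_hom_add[OF f] module_hom_smult[OF f])
qed

lemma pmod_iso_trans:
  assumes PQ: "pmod_iso K I E P Q" and QR: "pmod_iso K I E Q R" and E: "E \<subseteq> I \<times> I"
  shows "pmod_iso K I E P R"
proof -
  obtain f where f: "\<And>i. i \<in> I \<Longrightarrow> f i \<in> module_hom K (space P i) (space Q i)"
      "\<And>i. i \<in> I \<Longrightarrow> bij_betw (f i) (carrier (space P i)) (carrier (space Q i))"
      "\<And>i j x. (i, j) \<in> E \<Longrightarrow> x \<in> carrier (space P i) \<Longrightarrow> f j (arrow P i j x) = arrow Q i j (f i x)"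
    using PQ unfolding pmod_iso_def by blast
  obtain g where g: "\<And>i. i \<in> I \<Longrightarrow> g i \<in> module_hom K (space Q i) (space R i)"
      "\<And>i. i \<in> I \<Longrightarrow> bij_betw (g i) (carrier (space Q i)) (carrier (space R i))"
      "\<And>i j x. (i, j) \<in> E \<Longrightarrow> x \<in> carrier (space Q i) \<Longrightarrow> g j (arrow Q i j x) = arrow R i j (g i x)"
    using QR unfolding pmod_iso_def by blast
  have "f i x \<in> carrier (space Q i)" if "i \<in> I" "x \<in> carrier (space P i)" for i x
    using f(1) that by (auto dest: module_hom_closed)
  then have "g j (f j (arrow P i j x)) = arrow R i j (g i (f i x))"
    if "(i, j) \<in> E" "x \<in> carrier (space P i)" for i j x
    using that E by (auto simp: f(3) g(3))
  moreover have "bij_betw (\<lambda>x. g i (f i x)) (carrier (space P i)) (carrier (space R i))" if "i \<in> I" for i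
    using bij_betw_trans[OF f(2)[OF that] g(2)[OF that]] by (simp add: comp_def)
  ultimately show ?thesis
    unfolding pmod_iso_def
    by (intro exI[of _ "\<lambda>i x. g i (f i x)"]) (auto intro: module_hom_comp f(1) g(1))
qed

text \<open>\<open>pmod_iso\<close> does not ask its arguments to be persistence modules. The
  modules of \<open>P\<close> make the inverse maps linear, and closure of the arrows of
  \<open>P\<close> lets the inverse be commuted past them.\<close>

lemma pmod_iso_sym:
  assumes P: "persistence_module K I E P" and PQ: "pmod_iso K I E P Q" and E: "E \<subseteq> I \<times> I"
  shows "pmod_iso K I E Q P"
proof -
  obtain f where f: "\<And>i. i \<in> I \<Longrightarrow> f i \<in> module_hom K (space P i) (space Q i)"
      "\<And>i. i \<in> I \<Longrightarrow> bij_betw (f i) (carrier (space P i)) (carrier (space Q i))"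
      "\<And>i j x. (i, j) \<in> E \<Longrightarrow> x \<in> carrier (space P i) \<Longrightarrow> f j (arrow P i j x) = arrow Q i j (f i x)"
    using PQ unfolding pmod_iso_def by blast
  define g where "g i = inv_into (carrier (space P i)) (f i)" for i
  have g: "g i y \<in> carrier (space P i)" "f i (g i y) = y"
    if "i \<in> I" "y \<in> carrier (space Q i)" for i y
    using f(2)[OF that(1)] that(2) unfolding g_def
    by (auto simp: bij_betw_def intro: inv_into_into f_inv_into_f)
  have gf: "g i (f i x) = x" if "i \<in> I" "x \<in> carrier (space P i)" for i x
    using f(2)[OF that(1)] that(2) by (simp add: g_def bij_betw_def)
  have "g j (arrow Q i j y) = arrow P i j (g i y)"
    if ij: "(i, j) \<in> E" and y: "y \<in> carrier (space Q i)" for i j y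
  proof -
    have I: "i \<in> I" "j \<in> I" using ij E by auto
    have "arrow P i j (g i y) \<in> carrier (space P j)"
      using P ij g(1)[OF I(1) y] unfolding persistence_module_def
      by (auto dest!: module_hom_closed)
    then have "arrow P i j (g i y) = g j (f j (arrow P i j (g i y)))"
      by (simp add: gf I)
    also have "\<dots> = g j (arrow Q i j y)"
      by (simp add: f(3)[OF ij] g I y)
    finally show ?thesis by simp
  qed
  moreover have "g i \<in> module_hom K (space Q i) (space P i)" if "i \<in> I" for i
    unfolding g_def using P that f
    by (intro module_hom_inv_into) (auto simp: persistence_module_def vectorspace_def)
  moreover have "bij_betw (g i) (carrier (space Q i)) (carrier (space P i))" if "i \<in> I" for i
    unfolding g_def using f(2)[OF that] by (rule bij_betw_inv_into)
  ultimately show ?thesis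
    unfolding pmod_iso_def by (intro exI[of _ g]) auto
qed

text \<open>Moves a change of index from one side of an isomorphism to the other. As
  \<open>s\<close> carries \<open>F\<close> into \<open>E\<close>, an order-reversing
  \<open>s\<close> turns forward arrows into backward ones.\<close>

lemma pmod_iso_reindex:
  assumes "pmod_iso K I E (reindex r P) Q"
    and "\<And>j. j \<in> J \<Longrightarrow> s j \<in> I" and "\<And>j. j \<in> J \<Longrightarrow> r (s j) = j"
    and "\<And>i j. (i, j) \<in> F \<Longrightarrow> (s i, s j) \<in> E" and "F \<subseteq> J \<times> J"
  shows "pmod_iso K J F P (reindex s Q)"
proof -
  obtain f where f: "\<And>i. i \<in> I \<Longrightarrow> f i \<in> module_hom K (space P (r i)) (space Q i)"
      "\<And>i. i \<in> I \<Longrightarrow> bij_betw (f i) (carrier (space P (r i))) (carrier (space Q i))"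
      "\<And>i j x. (i, j) \<in> E \<Longrightarrow> x \<in> carrier (space P (r i)) \<Longrightarrow>
         f j (arrow P (r i) (r j) x) = arrow Q i j (f i x)"
    using assms(1) unfolding pmod_iso_def reindex_def by fastforce
  have "f (s j) \<in> module_hom K (space P j) (space Q (s j))"
    "bij_betw (f (s j)) (carrier (space P j)) (carrier (space Q (s j)))" if "j \<in> J" for j
    using f(1,2)[OF assms(2)[OF that]] assms(3)[OF that] by simp_all
  moreover have "f (s j) (arrow P i j x) = arrow Q (s i) (s j) (f (s i) x)"
    if "(i, j) \<in> F" "x \<in> carrier (space P i)" for i j x
  proof -
    have "i \<in> J" "j \<in> J" using that(1) assms(5) by auto
    then show ?thesis using f(3)[OF assms(4)[OF that(1)], of x] assms(3) that(2) by simp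
  qed
  ultimately show ?thesis
    unfolding pmod_iso_def reindex_def by (intro exI[of _ "\<lambda>j. f (s j)"]) auto
qed

section \<open>Reflection of interval modules\<close>

lemma func_space_simps:
  assumes "ring K"
  shows "carrier (ring.func_space K S) = S \<rightarrow>\<^sub>E carrier K"
    "\<zero>\<^bsub>ring.func_space K S\<^esub> = (\<lambda>x\<in>S. \<zero>\<^bsub>K\<^esub>)"
    "f \<oplus>\<^bsub>ring.func_space K S\<^esub> g = (\<lambda>x\<in>S. f x \<oplus>\<^bsub>K\<^esub> g x)"
    "a \<odot>\<^bsub>ring.func_space K S\<^esub> f = (\<lambda>x\<in>S. a \<otimes>\<^bsub>K\<^esub> f x)"
  by (simp_all add: ring.func_space_def[OF assms])

text \<open>A bar contains \<open>n - i\<close> exactly if its reflection contains \<open>i\<close>,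
  so reflecting the bars merely permutes the one-dimensional summands.\<close>

lemma pmod_iso_interval_sum_reverse:
  assumes K: "ring K" and M: "\<forall>(a, b)\<in>set_mset M. 1 \<le> a \<and> a \<le> b \<and> b \<le> n"
    and F: "F \<subseteq> {0..<n} \<times> {0..<n}"
  shows "pmod_iso K {0..<n} F (reindex (\<lambda>i. n - i) (interval_sum K M))
    (interval_sum K (image_mset (\<lambda>(a, b). (n - b, n - a)) M))"
proof -
  define h where "h = (\<lambda>(a, b). (n - b, n - a :: nat))"
  define M' where "M' = image_mset h M"
  define \<rho> where "\<rho> = (\<lambda>(p, k :: nat). (h p, k))"
  \<comment> \<open>Subtraction is truncated, so \<open>h\<close> is an involution only on pairs
    bounded by \<open>n\<close>; hence the restriction to bars of \<open>M\<close>, and below to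
    bars of \<open>M'\<close>.\<close>
  have hh: "h (h p) = p" if "p \<in># M" for p
    using M that by (auto simp: h_def)
  have hh': "h p \<in># M \<and> h (h p) = p" if "p \<in># M'" for p
    using that hh by (auto simp: M'_def)
  \<comment> \<open>\<open>image_mset\<close> adds multiplicities over the fibres of
    \<open>h\<close>; injectivity on the bars of \<open>M\<close> leaves a single summand.\<close>
  have count: "count M' (h p) = count M p" if "p \<in># M" for p
  proof -
    have "q = p" if "q \<in># M" "h q = h p" for q
      using hh \<open>p \<in># M\<close> that by metis
    then have "h -` {h p} \<inter> set_mset M = {p}"
      using that by auto
    then show ?thesis
      by (simp add: M'_def count_image_mset)
  qed
  have le: "snd p \<le> n" "fst p \<le> snd p" "1 \<le> fst p" if "p \<in># M" for p
    using M that by auto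
  have bars: "x \<in> bars_at N i \<longleftrightarrow> snd x < count N (fst x) \<and> fst (fst x) \<le> i \<and> i \<le> snd (fst x)" for x N i
    by (auto simp: bars_at_def)
  have in_bars: "fst x \<in># N" if "x \<in> bars_at N i" for x N i
    using that by (auto simp: bars simp flip: count_greater_zero_iff)
  have fst_h: "fst (h p) = n - snd p" "snd (h p) = n - fst p" for p
    by (auto simp: h_def split: prod.splits)
  have \<rho>_simps: "fst (\<rho> x) = h (fst x)" "snd (\<rho> x) = snd x" for x
    by (auto simp: \<rho>_def split: prod.splits)
  have \<rho>2: "\<rho> x \<in> bars_at M' j \<longleftrightarrow> x \<in> bars_at M (n - j)" if "fst x \<in># M" "j < n" for x j
    using le[OF that(1)] that(2) by (auto simp: bars \<rho>_simps fst_h count[OF that(1)])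
  have \<rho>\<rho>: "\<rho> (\<rho> x) = x" if "fst x \<in># M \<or> fst x \<in># M'" for x
    using hh[of "fst x"] hh'[of "fst x"] that by (intro prod_eqI) (auto simp: \<rho>_simps)
  have \<rho>_fwd: "\<rho> x \<in> bars_at M' j \<and> \<rho> (\<rho> x) = x" if "x \<in> bars_at M (n - j)" "j < n" for x j
    using \<rho>2 \<rho>\<rho> in_bars that by blast
  have \<rho>_bwd: "\<rho> x \<in> bars_at M (n - j) \<and> \<rho> (\<rho> x) = x" if "x \<in> bars_at M' j" "j < n" for x j
  proof -
    have "fst (\<rho> x) \<in># M" using hh' in_bars[OF that(1)] by (simp add: \<rho>_simps)
    then show ?thesis using \<rho>2[of "\<rho> x" j] \<rho>\<rho>[of x] in_bars[OF that(1)] that by simp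
  qed
  \<comment> \<open>Precomposition with \<open>\<rho>\<close>. Since \<open>\<rho>\<close> is its
    own inverse on the bars, the inverse of \<open>f j\<close> is again precomposition with
    \<open>\<rho>\<close>.\<close>
  define f where "f j v = (\<lambda>x\<in>bars_at M' j. v (\<rho> x))" for j and v :: "(nat \<times> nat) \<times> nat \<Rightarrow> 'a"
  have "f j \<in> module_hom K (ring.func_space K (bars_at M (n - j))) (ring.func_space K (bars_at M' j))"
    if "j < n" for j
    using \<rho>_bwd that
    by (intro module_homI) (auto simp: func_space_simps[OF K] f_def fun_eq_iff)
  moreover have "bij_betw (f j) (carrier (ring.func_space K (bars_at M (n - j))))
      (carrier (ring.func_space K (bars_at M' j)))" if "j < n" for j
  proof (rule bij_betw_byWitness[where f' = "\<lambda>v. \<lambda>x\<in>bars_at M (n - j). v (\<rho> x)"])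
    show "\<forall>a\<in>carrier (ring.func_space K (bars_at M (n - j))).
       (\<lambda>x\<in>bars_at M (n - j). f j a (\<rho> x)) = a"
      using \<rho>_fwd that by (auto simp: func_space_simps[OF K] f_def fun_eq_iff PiE_iff extensional_def)
    show "\<forall>a'\<in>carrier (ring.func_space K (bars_at M' j)).
       f j (\<lambda>x\<in>bars_at M (n - j). a' (\<rho> x)) = a'"
      using \<rho>_bwd that by (auto simp: func_space_simps[OF K] f_def fun_eq_iff PiE_iff extensional_def)
  qed (use that \<rho>_bwd \<rho>_fwd in \<open>auto simp: func_space_simps[OF K] f_def\<close>)
  moreover have "f j (arrow (interval_sum K M) (n - i) (n - j) v) = arrow (interval_sum K M') i j (f i v)"
    if "i < n" "j < n" for i j v
  proof
    fix x
    \<comment> \<open>An arrow keeps a coordinate exactly if its bar is also present at the source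
      index, so commutation amounts to this equivalence.\<close>
    have "\<rho> x \<in> bars_at M (n - i) \<longleftrightarrow> x \<in> bars_at M' i" if "x \<in> bars_at M' j"
      using \<rho>2[of "\<rho> x" i] \<rho>\<rho>[of x] in_bars[OF that] hh' \<open>i < n\<close> by (simp add: \<rho>_simps)
    then show "f j (arrow (interval_sum K M) (n - i) (n - j) v) x = arrow (interval_sum K M') i j (f i v) x"
      using \<rho>_bwd[OF _ \<open>j < n\<close>, of x] by (simp add: interval_sum_def f_def restrict_def)
  qed
  ultimately show ?thesis
    unfolding pmod_iso_def reindex_def h_def[symmetric] M'_def[symmetric]
    using F by (intro exI[of _ f]) (auto simp: interval_sum_def)
qed

section \<open>Maps of complexes and homology\<close>

text \<open>In this form a coset mentions only the addition, so it is the same for two records that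
  differ in their carriers alone, such as a space and its cycles.\<close>

lemma a_r_coset_eq_image: "H +>\<^bsub>V\<^esub> x = (\<lambda>h. h \<oplus>\<^bsub>V\<^esub> x) ` H"
  by (auto simp: a_r_coset_defs)

lemma set_add_eq: "X <+>\<^bsub>V\<^esub> Y = (\<Union>x\<in>X. \<Union>y\<in>Y. {x \<oplus>\<^bsub>V\<^esub> y})"
  by (simp add: set_add_defs)

lemma carrier_quot_space: "carrier (quot_space V W) = (\<lambda>x. W +>\<^bsub>V\<^esub> x) ` carrier V"
  by (auto simp: quot_space_def A_RCOSETS_defs a_r_coset_defs)

text \<open>Neither end has to be a module, so that homology can be compared without first showing
  it to be one.\<close>

definition linear_iso ::
    "('k, 'r) ring_scheme \<Rightarrow> ('k, 'v, 'm) module_scheme \<Rightarrow> ('k, 'w, 'p) module_scheme \<Rightarrow>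
     ('v \<Rightarrow> 'w) \<Rightarrow> bool" where
  "linear_iso K V W f \<longleftrightarrow> f \<in> module_hom K V W \<and> bij_betw f (carrier V) (carrier W)"

lemma linear_iso_inv_into:
  assumes "module K V" "linear_iso K V W f"
  shows "linear_iso K W V (inv_into (carrier V) f)"
  using assms module_hom_inv_into bij_betw_inv_into unfolding linear_iso_def by blast

text \<open>Linearity and square-zero of the differentials do not occur: cycles, boundaries and
  cosets are transported along \<open>f\<close> as sets. Closure of \<open>W\<close> under
  \<open>d'\<close> follows by conjugation, see \<open>chain_iso_inv\<close>.\<close>

locale chain_iso =
  V: module K V + W: module K W
  for K :: "('k, 'r) ring_scheme" and V :: "('k, 'v, 'm) module_scheme"
    and W :: "('k, 'w, 'p) module_scheme" +
  fixes d d' f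
  assumes iso: "linear_iso K V W f"
    and d_closed: "x \<in> carrier V \<Longrightarrow> d x \<in> carrier V"
    and commutes: "x \<in> carrier V \<Longrightarrow> f (d x) = d' (f x)"
begin

lemma hom: "f \<in> module_hom K V W" and bij: "bij_betw f (carrier V) (carrier W)"
  using iso by (simp_all add: linear_iso_def)

lemma closed: "x \<in> carrier V \<Longrightarrow> f x \<in> carrier W"
  using bij by (auto simp: bij_betw_def)

lemma image_boundaries: "f ` d ` carrier V = d' ` carrier W"
proof -
  have "f ` d ` carrier V = d' ` f ` carrier V"
    using commutes by (force simp: image_iff)
  then show ?thesis using bij by (simp add: bij_betw_def)
qed

lemma image_coset: "x \<in> carrier V \<Longrightarrow> f ` (d ` carrier V +>\<^bsub>V\<^esub> x) = d' ` carrier W +>\<^bsub>W\<^esub> f x"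
  using d_closed
  by (simp add: a_r_coset_eq_image image_image module_hom_add[OF hom] flip: image_boundaries)

lemma zero_iff:
  assumes "x \<in> carrier V"
  shows "f x = \<zero>\<^bsub>W\<^esub> \<longleftrightarrow> x = \<zero>\<^bsub>V\<^esub>"
proof -
  interpret mod_hom K V W f by unfold_locales (rule hom)
  show ?thesis
    using inj_on_eq_iff[OF bij_betw_imp_inj_on[OF bij] assms V.zero_closed] f0_is_0 by metis
qed

lemma image_cycles: "f ` {x \<in> carrier V. d x = \<zero>\<^bsub>V\<^esub>} = {y \<in> carrier W. d' y = \<zero>\<^bsub>W\<^esub>}"
proof -
  have "d' (f x) = \<zero>\<^bsub>W\<^esub> \<longleftrightarrow> d x = \<zero>\<^bsub>V\<^esub>" if "x \<in> carrier V" for x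
    using zero_iff[OF d_closed[OF that]] commutes[OF that] by simp
  moreover have "carrier W = f ` carrier V" using bij by (simp add: bij_betw_def)
  ultimately show ?thesis by auto
qed

lemma carrier_homology_V:
  "carrier (homology V d) = (\<lambda>x. d ` carrier V +>\<^bsub>V\<^esub> x) ` {x \<in> carrier V. d x = \<zero>\<^bsub>V\<^esub>}"
  by (simp add: homology_def carrier_quot_space a_r_coset_eq_image)

lemma carrier_homology_W:
  "carrier (homology W d') = (\<lambda>x. d' ` carrier W +>\<^bsub>W\<^esub> x) ` {x \<in> carrier W. d' x = \<zero>\<^bsub>W\<^esub>}"
  by (simp add: homology_def carrier_quot_space a_r_coset_eq_image)

lemma homology_subset: "X \<in> carrier (homology V d) \<Longrightarrow> X \<subseteq> carrier V"
  using d_closed by (auto simp: carrier_homology_V a_r_coset_eq_image)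

lemma image_homology: "image f ` carrier (homology V d) = carrier (homology W d')"
proof -
  have "image f ` carrier (homology V d) =
      (\<lambda>x. d' ` carrier W +>\<^bsub>W\<^esub> f x) ` {x \<in> carrier V. d x = \<zero>\<^bsub>V\<^esub>}"
    by (auto simp: carrier_homology_V image_image image_coset)
  also have "\<dots> = carrier (homology W d')"
    by (simp add: carrier_homology_W image_image flip: image_cycles)
  finally show ?thesis .
qed

text \<open>By \<open>image_coset\<close> the direct image of a class is a class, so no
  representative is chosen. The operations on classes are elementwise unions, with which direct
  images commute.\<close>

lemma linear_iso_homology: "linear_iso K (homology V d) (homology W d') (image f)"
proof -
  have "image f (X \<oplus>\<^bsub>homology V d\<^esub> Y) = image f X \<oplus>\<^bsub>homology W d'\<^esub> image f Y"
    if "X \<in> carrier (homology V d)" "Y \<in> carrier (homology V d)" for X Y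
  proof -
    have "f (x \<oplus>\<^bsub>V\<^esub> y) = f x \<oplus>\<^bsub>W\<^esub> f y" if "x \<in> X" "y \<in> Y" for x y
      using homology_subset[OF \<open>X \<in> _\<close>] homology_subset[OF \<open>Y \<in> _\<close>] that
      by (intro module_hom_add[OF hom]) auto
    then show ?thesis by (simp add: homology_def quot_space_def set_add_eq image_UN)
  qed
  moreover have "image f (a \<odot>\<^bsub>homology V d\<^esub> X) = a \<odot>\<^bsub>homology W d'\<^esub> image f X"
    if "a \<in> carrier K" "X \<in> carrier (homology V d)" for a X
  proof -
    have "f ` (d ` carrier V +>\<^bsub>V\<^esub> (a \<odot>\<^bsub>V\<^esub> x)) = d' ` carrier W +>\<^bsub>W\<^esub> (a \<odot>\<^bsub>W\<^esub> f x)" if "x \<in> X" for x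
      using homology_subset[OF \<open>X \<in> _\<close>] that \<open>a \<in> carrier K\<close>
      by (subst image_coset) (auto simp: module_hom_smult[OF hom])
    then show ?thesis by (simp add: homology_def quot_space_def image_UN a_r_coset_eq_image)
  qed
  \<comment> \<open>Classes are subsets of \<open>carrier V\<close>, where \<open>f\<close> is
    injective, so each is recovered from its image.\<close>
  moreover have "inj_on (image f) (carrier (homology V d))"
  proof (rule inj_onI)
    fix X Y
    assume XY: "X \<in> carrier (homology V d)" "Y \<in> carrier (homology V d)" "f ` X = f ` Y"
    then show "X = Y"
      using homology_subset bij inj_on_image_eq_iff[of f "carrier V" X Y] by (auto simp: bij_betw_def)
  qed
  moreover have "image f \<in> carrier (homology V d) \<rightarrow> carrier (homology W d')"
    using image_homology by blast
  ultimately show ?thesis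
    using image_homology unfolding linear_iso_def bij_betw_def
    by (intro conjI module_homI) simp_all
qed

end

text \<open>The natural chain map takes cochains to coordinates, but the comparison has to start at
  the coordinate side, where the output of the algorithm arrives. Inverting on chains needs only
  that cochains form a module.\<close>

lemma chain_iso_inv:
  assumes "chain_iso K V W d d' f"
  shows "chain_iso K W V d' d (inv_into (carrier V) f)"
proof -
  interpret chain_iso K V W d d' f by (fact assms)
  let ?g = "inv_into (carrier V) f"
  have g: "?g y \<in> carrier V" "f (?g y) = y" if "y \<in> carrier W" for y
    using bij that by (auto simp: bij_betw_def intro: inv_into_into f_inv_into_f)
  have gf: "?g (f x) = x" if "x \<in> carrier V" for x
    using bij that by (simp add: bij_betw_def)
  have d': "d' y = f (d (?g y))" if "y \<in> carrier W" for y
    using commutes[OF g(1)[OF that]] g(2)[OF that] by simp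
  show ?thesis
  proof unfold_locales
    show "linear_iso K W V ?g" by (rule linear_iso_inv_into[OF V.module_axioms iso])
    show "d' y \<in> carrier W" if "y \<in> carrier W" for y
      using that by (simp add: d' g closed d_closed)
    show "?g (d' y) = d (?g y)" if "y \<in> carrier W" for y
      using that by (simp add: d' g gf d_closed)
  qed
qed

text \<open>Naturality is checked on chains: an arrow sends a class to a union of cosets over all
  its members, and \<open>f j\<close> maps this union term by term. Independence of the
  representative is not an issue.\<close>

lemma pmod_iso_homology:
  assumes iso: "\<And>i. i \<in> I \<Longrightarrow> chain_iso K (V i) (W i) (d i) (d' i) (f i)"
    and g: "\<And>i j x. (i, j) \<in> E \<Longrightarrow> x \<in> carrier (V i) \<Longrightarrow> g i j x \<in> carrier (V j)"
    and fg: "\<And>i j x. (i, j) \<in> E \<Longrightarrow> x \<in> carrier (V i) \<Longrightarrow> f j (g i j x) = g' i j (f i x)"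
    and E: "E \<subseteq> I \<times> I"
  shows "pmod_iso K I E
    \<lparr>space = (\<lambda>i. homology (V i) (d i)),
     arrow = (\<lambda>i j. coset_map (V j) (d j ` carrier (V j)) (g i j))\<rparr>
    \<lparr>space = (\<lambda>i. homology (W i) (d' i)),
     arrow = (\<lambda>i j. coset_map (W j) (d' j ` carrier (W j)) (g' i j))\<rparr>"
proof -
  have arrows: "f j ` coset_map (V j) (d j ` carrier (V j)) (g i j) X =
      coset_map (W j) (d' j ` carrier (W j)) (g' i j) (f i ` X)"
    if ij: "(i, j) \<in> E" and X: "X \<in> carrier (homology (V i) (d i))" for i j X
  proof -
    have I: "i \<in> I" "j \<in> I" using E ij by auto
    interpret i: chain_iso K "V i" "W i" "d i" "d' i" "f i" by (rule iso[OF I(1)])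
    interpret j: chain_iso K "V j" "W j" "d j" "d' j" "f j" by (rule iso[OF I(2)])
    have "x \<in> carrier (V i)" if "x \<in> X" for x using i.homology_subset[OF X] that by auto
    then show ?thesis
      by (simp add: coset_map_def image_UN j.image_coset g[OF ij] fg[OF ij])
  qed
  show ?thesis
    using chain_iso.linear_iso_homology[OF iso]
    unfolding pmod_iso_def linear_iso_def
    by (intro exI[of _ "\<lambda>i. image (f i)"] conjI ballI) (simp_all add: case_prod_unfold arrows)
qed

section \<open>Coordinates with respect to a sequence of cells\<close>

text \<open>Stated for additive maps so as to cover coordinates and evaluations alike. For infinite
  \<open>A\<close> both sums are zero by convention, and \<open>h\<close> preserves zero by
  cancellation.\<close>

lemma additive_finsum:
  assumes V: "abelian_group V" and W: "abelian_group W"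
    and h: "h \<in> carrier V \<rightarrow> carrier W"
    and add: "\<And>x y. x \<in> carrier V \<Longrightarrow> y \<in> carrier V \<Longrightarrow> h (x \<oplus>\<^bsub>V\<^esub> y) = h x \<oplus>\<^bsub>W\<^esub> h y"
    and f: "f \<in> A \<rightarrow> carrier V"
  shows "h (finsum V f A) = (\<Oplus>\<^bsub>W\<^esub>a\<in>A. h (f a))"
proof -
  interpret V: abelian_group V by (fact V)
  interpret W: abelian_group W by (fact W)
  have "h \<zero>\<^bsub>V\<^esub> \<oplus>\<^bsub>W\<^esub> h \<zero>\<^bsub>V\<^esub> = h \<zero>\<^bsub>V\<^esub>" using add[of "\<zero>\<^bsub>V\<^esub>" "\<zero>\<^bsub>V\<^esub>"] by simp
  moreover have hz: "h \<zero>\<^bsub>V\<^esub> \<in> carrier W" using h by auto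
  ultimately have zero: "h \<zero>\<^bsub>V\<^esub> = \<zero>\<^bsub>W\<^esub>" using W.add.l_cancel_one' by metis
  show ?thesis
    using f
  proof (induction A rule: infinite_finite_induct)
    case (insert a A)
    have "f \<in> A \<rightarrow> carrier V" "f a \<in> carrier V" using insert.prems by auto
    moreover have "(\<lambda>x. h (f x)) \<in> A \<rightarrow> carrier W" "h (f a) \<in> carrier W" using insert.prems h by auto
    ultimately show ?case
      using insert by (simp add: add)
  qed (simp_all add: zero)
qed

section \<open>Dual spaces\<close>

lemma dual_space_simps:
  assumes "ring K"
  shows "f \<in> carrier (dual_space K V) \<longleftrightarrow> f \<in> carrier V \<rightarrow>\<^sub>E carrier K \<and>
      (\<forall>x\<in>carrier V. \<forall>y\<in>carrier V. f (x \<oplus>\<^bsub>V\<^esub> y) = f x \<oplus>\<^bsub>K\<^esub> f y) \<and>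
      (\<forall>a\<in>carrier K. \<forall>x\<in>carrier V. f (a \<odot>\<^bsub>V\<^esub> x) = a \<otimes>\<^bsub>K\<^esub> f x)"
    "\<zero>\<^bsub>dual_space K V\<^esub> = (\<lambda>x\<in>carrier V. \<zero>\<^bsub>K\<^esub>)"
    "f \<oplus>\<^bsub>dual_space K V\<^esub> g = (\<lambda>x\<in>carrier V. f x \<oplus>\<^bsub>K\<^esub> g x)"
    "a \<odot>\<^bsub>dual_space K V\<^esub> f = (\<lambda>x\<in>carrier V. a \<otimes>\<^bsub>K\<^esub> f x)"
  by (simp_all add: dual_space_def func_space_simps[OF assms])

text \<open>The functionals form a submodule of the function space, for which closure of
  \<open>V\<close> under its operations is enough. This allows \<open>V\<close> to be a quotient for
  which only closure has been checked.\<close>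

lemma module_dual_space:
  assumes K: "cring K"
    and add: "\<And>x y. x \<in> carrier V \<Longrightarrow> y \<in> carrier V \<Longrightarrow> x \<oplus>\<^bsub>V\<^esub> y \<in> carrier V"
    and smult: "\<And>a x. a \<in> carrier K \<Longrightarrow> x \<in> carrier V \<Longrightarrow> a \<odot>\<^bsub>V\<^esub> x \<in> carrier V"
  shows "module K (dual_space K V)"
proof -
  interpret cring K by (fact K)
  interpret F: module K "func_space (carrier V)" by (rule func_space_is_module)
  have "submodule K (carrier (dual_space K V)) (func_space (carrier V))"
  proof (rule submodule.intro)
    show "module K (func_space (carrier V))" by (rule func_space_is_module)
    show "carrier (dual_space K V) \<subseteq> carrier (func_space (carrier V))"
      by (auto simp: dual_space_simps[OF ring_axioms] func_space_simps[OF ring_axioms])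
    show "\<zero>\<^bsub>func_space (carrier V)\<^esub> \<in> carrier (dual_space K V)"
      by (auto simp: dual_space_simps[OF ring_axioms] func_space_simps[OF ring_axioms] add smult)
    show "v \<oplus>\<^bsub>func_space (carrier V)\<^esub> w \<in> carrier (dual_space K V)"
      if "v \<in> carrier (dual_space K V)" "w \<in> carrier (dual_space K V)" for v w
    proof -
      have "v x \<in> carrier K" "w x \<in> carrier K" if "x \<in> carrier V" for x
        using \<open>v \<in> _\<close> \<open>w \<in> _\<close> that by (auto simp: dual_space_simps[OF ring_axioms])
      then show ?thesis
        using that by (auto simp: dual_space_simps[OF ring_axioms] func_space_simps[OF ring_axioms]
          add smult a_ac r_distr)
    qed
    show "c \<odot>\<^bsub>func_space (carrier V)\<^esub> v \<in> carrier (dual_space K V)"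
      if "c \<in> carrier K" "v \<in> carrier (dual_space K V)" for c v
    proof -
      have "v x \<in> carrier K" if "x \<in> carrier V" for x
        using \<open>v \<in> _\<close> that by (auto simp: dual_space_simps[OF ring_axioms])
      then show ?thesis
        using that by (auto simp: dual_space_simps[OF ring_axioms] func_space_simps[OF ring_axioms]
          add smult r_distr m_lcomm)
    qed
  qed
  moreover have "dual_space K V = (func_space (carrier V))\<lparr>carrier := carrier (dual_space K V)\<rparr>"
    by (simp add: dual_space_def)
  ultimately show ?thesis
    using F.submodule_is_module by metis
qed

text \<open>A basis packaged with its coordinate functionals, both indexed by cell number rather
  than by vector. It is instantiated by the given cells, by the unit vectors, and by the dual cells,
  whose coordinates are evaluations.\<close>

locale cell_coordinates = vectorspace K V
  for K :: "('k, 'r) ring_scheme" and V :: "('k, 'v, 'm) module_scheme" +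
  fixes n :: nat and \<sigma> :: "nat \<Rightarrow> 'v" and e :: "nat \<Rightarrow> 'v \<Rightarrow> 'k"
  assumes cell_closed: "i \<in> {1..n} \<Longrightarrow> \<sigma> i \<in> carrier V"
    and coord_closed: "i \<in> {1..n} \<Longrightarrow> x \<in> carrier V \<Longrightarrow> e i x \<in> carrier K"
    and coord_add: "i \<in> {1..n} \<Longrightarrow> x \<in> carrier V \<Longrightarrow> y \<in> carrier V \<Longrightarrow> e i (x \<oplus>\<^bsub>V\<^esub> y) = e i x \<oplus>\<^bsub>K\<^esub> e i y"
    and coord_smult: "i \<in> {1..n} \<Longrightarrow> a \<in> carrier K \<Longrightarrow> x \<in> carrier V \<Longrightarrow> e i (a \<odot>\<^bsub>V\<^esub> x) = a \<otimes>\<^bsub>K\<^esub> e i x"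
    and coord_cell: "i \<in> {1..n} \<Longrightarrow> j \<in> {1..n} \<Longrightarrow> e i (\<sigma> j) = (if i = j then \<one>\<^bsub>K\<^esub> else \<zero>\<^bsub>K\<^esub>)"
    and expansion: "x \<in> carrier V \<Longrightarrow> (\<Oplus>\<^bsub>V\<^esub>i\<in>{1..n}. e i x \<odot>\<^bsub>V\<^esub> \<sigma> i) = x"

text \<open>The coordinates are the inverse of the isomorphism that sends a coefficient function on
  the basis to its linear combination.\<close>

lemma (in vectorspace) obtain_cell_coordinates:
  assumes inj: "inj_on \<sigma> {1..n}" and basis: "basis (\<sigma> ` {1..n})"
  obtains e where "cell_coordinates K V n \<sigma> e"
proof -
  let ?S = "\<sigma> ` {1..n}"
  have fin: "finite ?S" and S: "?S \<subseteq> carrier V" using basis by (auto simp: basis_def)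
  let ?L = "\<lambda>a. lincomb a ?S"
  interpret L: linear_map K "func_space ?S" V ?L by (rule lincomb_is_linear[OF fin S])
  note FS = func_space_simps[OF R.ring_axioms]
  have unique: "\<exists>!a. a \<in> ?S \<rightarrow>\<^sub>E carrier K \<and> ?L a = x" if "x \<in> carrier V" for x
    using basis_criterion[OF fin S] basis that by blast
  have iso: "linear_iso K (func_space ?S) V ?L"
    unfolding linear_iso_def bij_betw_def
  proof (intro conjI)
    show "?L \<in> module_hom K (func_space ?S) V" by (rule L.f_hom)
    show "inj_on ?L (carrier (func_space ?S))"
      using unique L.f_im by (intro inj_onI) (auto simp: FS, metis)
    show "?L ` carrier (func_space ?S) = carrier V"
      using unique L.f_im by (force simp: FS)
  qed
  define c where "c = inv_into (carrier (func_space ?S)) ?L"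
  have c: "c \<in> module_hom K V (func_space ?S)"
    using linear_iso_inv_into[OF func_space_is_module iso] by (simp add: c_def linear_iso_def)
  have cS: "c x \<in> ?S \<rightarrow>\<^sub>E carrier K" if "x \<in> carrier V" for x
    using module_hom_closed[OF c] that by (auto simp: FS)
  have Lc: "?L (c x) = x" if "x \<in> carrier V" for x
  proof -
    have "x \<in> ?L ` carrier (func_space ?S)" using iso that by (simp only: linear_iso_def bij_betw_def)
    from f_inv_into_f[OF this] show ?thesis by (simp add: c_def)
  qed
  have cL: "c (?L a) = a" if "a \<in> ?S \<rightarrow>\<^sub>E carrier K" for a
    unfolding c_def using iso that
    by (intro inv_into_f_f) (auto simp: linear_iso_def bij_betw_def FS)
  have "cell_coordinates K V n \<sigma> (\<lambda>i x. c x (\<sigma> i))"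
  proof unfold_locales
    fix i assume i: "i \<in> {1..n}"
    show "\<sigma> i \<in> carrier V" using S i by auto
    show "c x (\<sigma> i) \<in> carrier K" if "x \<in> carrier V" for x using cS[OF that] i by auto
    show "c (x \<oplus>\<^bsub>V\<^esub> y) (\<sigma> i) = c x (\<sigma> i) \<oplus>\<^bsub>K\<^esub> c y (\<sigma> i)" if "x \<in> carrier V" "y \<in> carrier V" for x y
      using that i by (simp add: module_hom_add[OF c] FS)
    show "c (a \<odot>\<^bsub>V\<^esub> x) (\<sigma> i) = a \<otimes>\<^bsub>K\<^esub> c x (\<sigma> i)" if "a \<in> carrier K" "x \<in> carrier V" for a x
      using that i by (simp add: module_hom_smult[OF c] FS)
    show "c (\<sigma> j) (\<sigma> i) = (if i = j then \<one>\<^bsub>K\<^esub> else \<zero>\<^bsub>K\<^esub>)" if j: "j \<in> {1..n}" for j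
    proof -
      \<comment> \<open>The coefficient function of a basis vector is its indicator; injectivity of
        \<open>\<sigma>\<close> then turns equality of vectors into equality of indices.\<close>
      let ?a = "\<lambda>s\<in>?S. if s = \<sigma> j then \<one>\<^bsub>K\<^esub> else \<zero>\<^bsub>K\<^esub>"
      have "?L ?a = (\<Oplus>\<^bsub>V\<^esub>s\<in>?S. if \<sigma> j = s then s else \<zero>\<^bsub>V\<^esub>)"
        unfolding lincomb_def using S by (intro finsum_cong') auto
      also have "\<dots> = \<sigma> j"
        using fin S j by (intro M.add.finprod_singleton) auto
      finally have "c (\<sigma> j) = ?a" using cL[of ?a] by auto
      moreover have "\<sigma> i = \<sigma> j \<longleftrightarrow> i = j" using inj_on_eq_iff[OF inj i j] .
      moreover have "\<sigma> i \<in> ?S" using i by (rule imageI)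
      ultimately show ?thesis by (simp only: restrict_apply if_True)
    qed
  next
    fix x assume x: "x \<in> carrier V"
    have "?L (c x) = (\<Oplus>\<^bsub>V\<^esub>i\<in>{1..n}. c x (\<sigma> i) \<odot>\<^bsub>V\<^esub> \<sigma> i)"
      unfolding lincomb_def using inj S cS[OF x] by (intro M.add.finprod_reindex) auto
    then show "(\<Oplus>\<^bsub>V\<^esub>i\<in>{1..n}. c x (\<sigma> i) \<odot>\<^bsub>V\<^esub> \<sigma> i) = x" using Lc[OF x] by simp
  qed
  then show thesis by (rule that)
qed

context cell_coordinates
begin

lemma coord_finsum:
  assumes "i \<in> {1..n}" and "f \<in> A \<rightarrow> carrier V"
  shows "e i (finsum V f A) = (\<Oplus>\<^bsub>K\<^esub>a\<in>A. e i (f a))"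
  using assms by (intro additive_finsum M.abelian_group_axioms R.abelian_group_axioms coord_add)
    (auto intro: coord_closed)

lemma coord_comb:
  assumes i: "i \<in> {1..n}" and c: "c \<in> {1..n} \<rightarrow> carrier K"
  shows "e i (\<Oplus>\<^bsub>V\<^esub>j\<in>{1..n}. c j \<odot>\<^bsub>V\<^esub> \<sigma> j) = c i"
proof -
  have "e i (\<Oplus>\<^bsub>V\<^esub>j\<in>{1..n}. c j \<odot>\<^bsub>V\<^esub> \<sigma> j) = (\<Oplus>\<^bsub>K\<^esub>j\<in>{1..n}. e i (c j \<odot>\<^bsub>V\<^esub> \<sigma> j))"
    using c cell_closed by (intro coord_finsum[OF i]) auto
  also have "\<dots> = (\<Oplus>\<^bsub>K\<^esub>j\<in>{1..n}. if i = j then c j else \<zero>\<^bsub>K\<^esub>)"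
    using c i cell_closed by (intro R.finsum_cong') (auto simp: coord_smult coord_cell Pi_iff)
  also have "\<dots> = c i"
    using c i by (intro R.add.finprod_singleton) auto
  finally show ?thesis .
qed

lemma coord_eqI:
  assumes "x \<in> carrier V" "y \<in> carrier V" "\<And>i. i \<in> {1..n} \<Longrightarrow> e i x = e i y"
  shows "x = y"
proof -
  have "(\<Oplus>\<^bsub>V\<^esub>i\<in>{1..n}. e i x \<odot>\<^bsub>V\<^esub> \<sigma> i) = (\<Oplus>\<^bsub>V\<^esub>i\<in>{1..n}. e i y \<odot>\<^bsub>V\<^esub> \<sigma> i)"
    using assms cell_closed coord_closed by (intro finsum_cong') auto
  then show ?thesis using expansion assms by simp
qed

lemma coord_zero: "i \<in> {1..n} \<Longrightarrow> e i \<zero>\<^bsub>V\<^esub> = \<zero>\<^bsub>K\<^esub>"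
  using coord_finsum[of i "\<lambda>_. \<zero>\<^bsub>V\<^esub>" "{}"] by simp

text \<open>If two indices gave the same vector, one coordinate would be both one and zero
  there.\<close>

lemma inj_cells: "inj_on \<sigma> {1..n}"
proof (rule inj_onI)
  fix i j assume ij: "i \<in> {1..n}" "j \<in> {1..n}" "\<sigma> i = \<sigma> j"
  then have "(if i = j then \<one>\<^bsub>K\<^esub> else \<zero>\<^bsub>K\<^esub>) = \<one>\<^bsub>K\<^esub>"
    using coord_cell[of i j] coord_cell[of i i] by simp
  then show "i = j" by (simp split: if_splits)
qed

text \<open>Padding with zero coefficients brings a combination of the first \<open>m\<close> cells
  into the form from which \<open>coord_comb\<close> reads coordinates.\<close>

lemma lincomb_cells:
  assumes "m \<le> n" "a \<in> \<sigma> ` {1..m} \<rightarrow> carrier K"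
  shows "lincomb a (\<sigma> ` {1..m}) =
    (\<Oplus>\<^bsub>V\<^esub>i\<in>{1..n}. (if i \<le> m then a (\<sigma> i) else \<zero>\<^bsub>K\<^esub>) \<odot>\<^bsub>V\<^esub> \<sigma> i)"
proof -
  have aK: "a (\<sigma> i) \<in> carrier K" if "i \<in> {1..m}" for i
    using assms(2) that by blast
  have "lincomb a (\<sigma> ` {1..m}) = (\<Oplus>\<^bsub>V\<^esub>i\<in>{1..m}. a (\<sigma> i) \<odot>\<^bsub>V\<^esub> \<sigma> i)"
    unfolding lincomb_def using aK assms(1) cell_closed
    by (intro M.add.finprod_reindex) (auto intro: inj_on_subset[OF inj_cells])
  also have "\<dots> = (\<Oplus>\<^bsub>V\<^esub>i\<in>{1..n}. (if i \<le> m then a (\<sigma> i) else \<zero>\<^bsub>K\<^esub>) \<odot>\<^bsub>V\<^esub> \<sigma> i)"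
    using aK assms(1) cell_closed by (intro M.add.finprod_mono_neutral_cong_left) auto
  finally show ?thesis .
qed

text \<open>The working description of the filtration: its monotonicity, its invariance under the
  boundary and the coordinate description \<open>carrier_W\<close> are all derived from it.\<close>

lemma cell_span_iff:
  assumes m: "m \<le> n"
  shows "x \<in> cell_span K V \<sigma> m \<longleftrightarrow> x \<in> carrier V \<and> (\<forall>i\<in>{1..n}. m < i \<longrightarrow> e i x = \<zero>\<^bsub>K\<^esub>)"
proof -
  have span: "cell_span K V \<sigma> m = {lincomb a (\<sigma> ` {1..m}) | a. a \<in> \<sigma> ` {1..m} \<rightarrow> carrier K}"
    unfolding cell_span_def using m cell_closed by (intro finite_span) auto
  show ?thesis
  proof
    assume "x \<in> cell_span K V \<sigma> m"
    then obtain a where a: "a \<in> \<sigma> ` {1..m} \<rightarrow> carrier K" "x = lincomb a (\<sigma> ` {1..m})"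
      unfolding span by auto
    let ?c = "\<lambda>i. if i \<le> m then a (\<sigma> i) else \<zero>\<^bsub>K\<^esub>"
    have "a (\<sigma> i) \<in> carrier K" if "i \<in> {1..m}" for i using a that by blast
    then have c: "?c \<in> {1..n} \<rightarrow> carrier K" by auto
    have x: "x = (\<Oplus>\<^bsub>V\<^esub>i\<in>{1..n}. ?c i \<odot>\<^bsub>V\<^esub> \<sigma> i)"
      using a lincomb_cells[OF m] by simp
    have "x \<in> carrier V" unfolding x using c cell_closed by (intro finsum_closed) auto
    moreover have "e i x = ?c i" if "i \<in> {1..n}" for i
      unfolding x by (rule coord_comb[OF that c])
    ultimately show "x \<in> carrier V \<and> (\<forall>i\<in>{1..n}. m < i \<longrightarrow> e i x = \<zero>\<^bsub>K\<^esub>)" by simp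
  next
    assume x: "x \<in> carrier V \<and> (\<forall>i\<in>{1..n}. m < i \<longrightarrow> e i x = \<zero>\<^bsub>K\<^esub>)"
    \<comment> \<open>\<open>lincomb\<close> takes coefficients indexed by vectors, so the
      coordinates are carried over along the inverse of \<open>\<sigma>\<close>.\<close>
    define a where "a s = e (the_inv_into {1..n} \<sigma> s) x" for s
    have a: "a (\<sigma> i) = e i x" if "i \<in> {1..n}" for i
      using the_inv_into_f_f[OF inj_cells that] by (simp add: a_def)
    then have aK: "a \<in> \<sigma> ` {1..m} \<rightarrow> carrier K" using x m coord_closed by auto
    have "x = (\<Oplus>\<^bsub>V\<^esub>i\<in>{1..n}. e i x \<odot>\<^bsub>V\<^esub> \<sigma> i)" using expansion x by simp
    also have "\<dots> = (\<Oplus>\<^bsub>V\<^esub>i\<in>{1..n}. (if i \<le> m then a (\<sigma> i) else \<zero>\<^bsub>K\<^esub>) \<odot>\<^bsub>V\<^esub> \<sigma> i)"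
      using x m a cell_closed coord_closed by (intro finsum_cong') auto
    also have "\<dots> = lincomb a (\<sigma> ` {1..m})" using lincomb_cells[OF m aK] by simp
    finally show "x \<in> cell_span K V \<sigma> m" unfolding span using aK by auto
  qed
qed

text \<open>The way back from coordinates to a basis, which \<open>formal_cells\<close> requires of
  the dual cells.\<close>

lemma basis_cells: "basis (\<sigma> ` {1..n})"
proof -
  have S: "\<sigma> ` {1..n} \<subseteq> carrier V" using cell_closed by auto
  have "span (\<sigma> ` {1..n}) = carrier V"
    using cell_span_iff[of n] unfolding cell_span_def by auto
  moreover have "lin_indpt (\<sigma> ` {1..n})"
  proof (rule finite_lin_indpt2[OF _ S])
    fix a assume a: "a \<in> \<sigma> ` {1..n} \<rightarrow> carrier K" "lincomb a (\<sigma> ` {1..n}) = \<zero>\<^bsub>V\<^esub>"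
    have "a (\<sigma> i) = \<zero>\<^bsub>K\<^esub>" if "i \<in> {1..n}" for i
      using coord_comb[OF that, of "\<lambda>i. if i \<le> n then a (\<sigma> i) else \<zero>\<^bsub>K\<^esub>"] lincomb_cells[of n a] a
        coord_zero[OF that] that by (auto simp: Pi_iff)
    then show "\<forall>v\<in>\<sigma> ` {1..n}. a v = \<zero>\<^bsub>K\<^esub>" by auto
  qed simp
  ultimately show ?thesis using S by (simp add: basis_def)
qed

lemma functional_expansion:
  assumes g: "g \<in> carrier (dual_space K V)" and x: "x \<in> carrier V"
  shows "g x = (\<Oplus>\<^bsub>K\<^esub>i\<in>{1..n}. e i x \<otimes>\<^bsub>K\<^esub> g (\<sigma> i))"
proof -
  note g = g[unfolded dual_space_simps[OF R.ring_axioms]]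
  have g\<sigma>: "g (\<sigma> i) \<in> carrier K" if "i \<in> {1..n}" for i using g cell_closed[OF that] by auto
  have "g x = g (\<Oplus>\<^bsub>V\<^esub>i\<in>{1..n}. e i x \<odot>\<^bsub>V\<^esub> \<sigma> i)" by (simp only: expansion[OF x])
  also have "\<dots> = (\<Oplus>\<^bsub>K\<^esub>i\<in>{1..n}. g (e i x \<odot>\<^bsub>V\<^esub> \<sigma> i))"
    using g x coord_closed cell_closed
    by (intro additive_finsum M.abelian_group_axioms R.abelian_group_axioms) auto
  also have "\<dots> = (\<Oplus>\<^bsub>K\<^esub>i\<in>{1..n}. e i x \<otimes>\<^bsub>K\<^esub> g (\<sigma> i))"
    using g g\<sigma> x coord_closed cell_closed by (intro R.finsum_cong') auto
  finally show ?thesis .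
qed

lemma functional_eqI:
  assumes "g \<in> carrier (dual_space K V)" "h \<in> carrier (dual_space K V)"
    and "\<And>i. i \<in> {1..n} \<Longrightarrow> g (\<sigma> i) = h (\<sigma> i)"
  shows "g = h"
proof
  fix x
  show "g x = h x"
  proof (cases "x \<in> carrier V")
    case True
    have "h (\<sigma> i) \<in> carrier K" if "i \<in> {1..n}" for i
      using assms(2) cell_closed[OF that] by (auto simp: dual_space_simps[OF R.ring_axioms])
    then have "(\<Oplus>\<^bsub>K\<^esub>i\<in>{1..n}. e i x \<otimes>\<^bsub>K\<^esub> g (\<sigma> i)) = (\<Oplus>\<^bsub>K\<^esub>i\<in>{1..n}. e i x \<otimes>\<^bsub>K\<^esub> h (\<sigma> i))"
      using assms(3) coord_closed[OF _ True] by (intro R.finsum_cong') auto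
    then show ?thesis using functional_expansion True assms(1,2) by simp
  next
    case False
    then show ?thesis
      using assms(1,2) by (auto simp: dual_space_simps[OF R.ring_axioms] PiE_iff extensional_def)
  qed
qed

text \<open>The formula is exported next to the values on cells because vanishing on a span will be
  read off from it term by term.\<close>

lemma functional_exists:
  assumes c: "c \<in> {1..n} \<rightarrow> carrier K"
  obtains g where "g \<in> carrier (dual_space K V)" "\<And>i. i \<in> {1..n} \<Longrightarrow> g (\<sigma> i) = c i"
    "\<And>x. x \<in> carrier V \<Longrightarrow> g x = (\<Oplus>\<^bsub>K\<^esub>i\<in>{1..n}. e i x \<otimes>\<^bsub>K\<^esub> c i)"
proof
  let ?g = "\<lambda>x\<in>carrier V. \<Oplus>\<^bsub>K\<^esub>i\<in>{1..n}. e i x \<otimes>\<^bsub>K\<^esub> c i"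
  have term_closed: "e i x \<otimes>\<^bsub>K\<^esub> c i \<in> carrier K" if "x \<in> carrier V" "i \<in> {1..n}" for x i
    using that c coord_closed[OF that(2,1)] by auto
  have "?g (x \<oplus>\<^bsub>V\<^esub> y) = ?g x \<oplus>\<^bsub>K\<^esub> ?g y" if xy: "x \<in> carrier V" "y \<in> carrier V" for x y
  proof -
    have "(\<Oplus>\<^bsub>K\<^esub>i\<in>{1..n}. e i (x \<oplus>\<^bsub>V\<^esub> y) \<otimes>\<^bsub>K\<^esub> c i) =
        (\<Oplus>\<^bsub>K\<^esub>i\<in>{1..n}. e i x \<otimes>\<^bsub>K\<^esub> c i \<oplus>\<^bsub>K\<^esub> e i y \<otimes>\<^bsub>K\<^esub> c i)"
      using c xy coord_closed
      by (intro R.finsum_cong') (auto simp: coord_add R.l_distr Pi_iff)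
    also have "\<dots> = (\<Oplus>\<^bsub>K\<^esub>i\<in>{1..n}. e i x \<otimes>\<^bsub>K\<^esub> c i) \<oplus>\<^bsub>K\<^esub> (\<Oplus>\<^bsub>K\<^esub>i\<in>{1..n}. e i y \<otimes>\<^bsub>K\<^esub> c i)"
      using term_closed xy by (intro R.finsum_addf) auto
    finally show ?thesis using xy by simp
  qed
  moreover have "?g (a \<odot>\<^bsub>V\<^esub> x) = a \<otimes>\<^bsub>K\<^esub> ?g x" if ax: "a \<in> carrier K" "x \<in> carrier V" for a x
  proof -
    have "(\<Oplus>\<^bsub>K\<^esub>i\<in>{1..n}. e i (a \<odot>\<^bsub>V\<^esub> x) \<otimes>\<^bsub>K\<^esub> c i) = (\<Oplus>\<^bsub>K\<^esub>i\<in>{1..n}. a \<otimes>\<^bsub>K\<^esub> (e i x \<otimes>\<^bsub>K\<^esub> c i))"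
      using c ax coord_closed
      by (intro R.finsum_cong') (auto simp: coord_smult R.m_assoc Pi_iff)
    also have "\<dots> = a \<otimes>\<^bsub>K\<^esub> (\<Oplus>\<^bsub>K\<^esub>i\<in>{1..n}. e i x \<otimes>\<^bsub>K\<^esub> c i)"
      using term_closed ax by (intro R.finsum_rdistr[symmetric]) auto
    finally show ?thesis using ax by simp
  qed
  ultimately show "?g \<in> carrier (dual_space K V)"
    using term_closed by (auto simp: dual_space_simps[OF R.ring_axioms])
  show "?g (\<sigma> i) = c i" if i: "i \<in> {1..n}" for i
  proof -
    have "(\<Oplus>\<^bsub>K\<^esub>j\<in>{1..n}. e j (\<sigma> i) \<otimes>\<^bsub>K\<^esub> c j) = (\<Oplus>\<^bsub>K\<^esub>j\<in>{1..n}. if i = j then c j else \<zero>\<^bsub>K\<^esub>)"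
      using c i by (intro R.finsum_cong') (auto simp: coord_cell Pi_iff)
    also have "\<dots> = c i" using c i by (intro R.add.finprod_singleton) auto
    finally show ?thesis using cell_closed[OF i] by simp
  qed
qed simp

end

section \<open>Quotients by subspaces\<close>

lemma quot_space_simps:
  "\<zero>\<^bsub>quot_space V H\<^esub> = H" "X \<oplus>\<^bsub>quot_space V H\<^esub> Y = X <+>\<^bsub>V\<^esub> Y"
  "a \<odot>\<^bsub>quot_space V H\<^esub> X = coset_map V H (\<lambda>x. a \<odot>\<^bsub>V\<^esub> x) X"
  by (simp_all add: quot_space_def coset_map_def)

context module
begin

text \<open>Opens the theory of additive cosets to submodules; closure under negation is closure
  under scaling by minus one.\<close>

lemma submodule_abelian_subgroup:
  assumes "submodule R H M"
  shows "abelian_subgroup H M"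
proof (rule abelian_subgroupI3[OF _ M.abelian_group_axioms])
  interpret H: submodule R H M by (fact assms)
  have "\<ominus>\<^bsub>M\<^esub> x \<in> H" if "x \<in> H" for x
  proof -
    have "\<ominus>\<^bsub>M\<^esub> x = (\<ominus>\<^bsub>R\<^esub> \<one>\<^bsub>R\<^esub>) \<odot>\<^bsub>M\<^esub> x" using smult_minus_1[of x] H.subset that by auto
    also have "\<dots> \<in> H" using that by (intro H.smult_closed) auto
    finally show ?thesis .
  qed
  moreover have "H \<noteq> {}" using H.zero_closed by blast
  ultimately show "additive_subgroup H M"
    using H.subset
    by (intro additive_subgroupI M.add.subgroupI) (auto simp flip: a_inv_def)
qed

lemma coset_add_left:
  assumes "submodule R H M" "h \<in> H" "x \<in> carrier M"
  shows "H +>\<^bsub>M\<^esub> (h \<oplus>\<^bsub>M\<^esub> x) = H +>\<^bsub>M\<^esub> x"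
proof -
  interpret abelian_subgroup H M by (rule submodule_abelian_subgroup[OF assms(1)])
  show ?thesis using assms(2,3) by (intro a_repr_independence'[symmetric]) (auto simp: a_r_coset_eq_image)
qed

lemma coset_add:
  assumes "submodule R H M" "x \<in> carrier M" "y \<in> carrier M"
  shows "(H +>\<^bsub>M\<^esub> x) \<oplus>\<^bsub>quot_space M H\<^esub> (H +>\<^bsub>M\<^esub> y) = H +>\<^bsub>M\<^esub> (x \<oplus>\<^bsub>M\<^esub> y)"
proof -
  interpret abelian_subgroup H M by (rule submodule_abelian_subgroup[OF assms(1)])
  show ?thesis using assms(2,3) by (simp add: quot_space_simps a_rcos_sum)
qed

text \<open>Two members of a coset differ by an element of \<open>H\<close>, whose image is absorbed
  by \<open>H'\<close>, so the union in \<open>coset_map\<close> collapses to one coset. Additivity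
  suffices, which covers scalings, the boundary and the identity.\<close>

lemma coset_map_coset:
  assumes H: "submodule R H M" and H': "submodule R H' M"
    and f: "f \<in> carrier M \<rightarrow> carrier M"
    and add: "\<And>x y. x \<in> carrier M \<Longrightarrow> y \<in> carrier M \<Longrightarrow> f (x \<oplus>\<^bsub>M\<^esub> y) = f x \<oplus>\<^bsub>M\<^esub> f y"
    and HH': "f ` H \<subseteq> H'" and x: "x \<in> carrier M"
  shows "coset_map M H' f (H +>\<^bsub>M\<^esub> x) = H' +>\<^bsub>M\<^esub> f x"
proof -
  have "H' +>\<^bsub>M\<^esub> f (h \<oplus>\<^bsub>M\<^esub> x) = H' +>\<^bsub>M\<^esub> f x" if "h \<in> H" for h
  proof -
    have "h \<in> carrier M" using H that by (auto simp: submodule_def)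
    then show ?thesis
      using that HH' f x coset_add_left[OF H', of "f h" "f x"] by (auto simp: add)
  qed
  moreover have "H \<noteq> {}" using submodule.zero_closed[OF H] by auto
  ultimately show ?thesis by (simp add: coset_map_def a_r_coset_eq_image[of V H for V])
qed

lemma coset_smult:
  assumes "submodule R H M" "a \<in> carrier R" "x \<in> carrier M"
  shows "a \<odot>\<^bsub>quot_space M H\<^esub> (H +>\<^bsub>M\<^esub> x) = H +>\<^bsub>M\<^esub> (a \<odot>\<^bsub>M\<^esub> x)"
  unfolding quot_space_simps
  using assms by (intro coset_map_coset) (auto simp: smult_r_distr submodule_def)

lemma coset_eq_subspace:
  assumes "submodule R H M" "x \<in> H"
  shows "H +>\<^bsub>M\<^esub> x = H"
proof -
  interpret abelian_subgroup H M by (rule submodule_abelian_subgroup[OF assms(1)])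
  show ?thesis using assms(2) a_coset_join2[OF _ a_subgroup] by auto
qed

section \<open>The dual of a quotient as an annihilator\<close>

lemma module_dual_quot_space:
  assumes H: "submodule R H M"
  shows "module R (dual_space R (quot_space M H))"
  using assms
  by (intro module_dual_space R.is_cring) (auto simp: carrier_quot_space coset_add coset_smult)

text \<open>One half of the identification of the dual of a quotient with the functionals vanishing
  on \<open>H\<close>; \<open>dual_quot_space_lift\<close> is the other half.\<close>

lemma dual_quot_space_pullback:
  assumes H: "submodule R H M" and \<phi>: "\<phi> \<in> carrier (dual_space R (quot_space M H))"
  shows "(\<lambda>x\<in>carrier M. \<phi> (H +>\<^bsub>M\<^esub> x)) \<in> carrier (dual_space R M)"
    and "x \<in> H \<Longrightarrow> \<phi> (H +>\<^bsub>M\<^esub> x) = \<zero>\<^bsub>R\<^esub>"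
proof -
  note \<phi> = \<phi>[unfolded dual_space_simps[OF R.ring_axioms] carrier_quot_space]
  have \<phi>K: "\<phi> (H +>\<^bsub>M\<^esub> x) \<in> carrier R" if "x \<in> carrier M" for x using \<phi> that by auto
  have \<phi>_add: "\<phi> (H +>\<^bsub>M\<^esub> (x \<oplus>\<^bsub>M\<^esub> y)) = \<phi> (H +>\<^bsub>M\<^esub> x) \<oplus>\<^bsub>R\<^esub> \<phi> (H +>\<^bsub>M\<^esub> y)"
    if "x \<in> carrier M" "y \<in> carrier M" for x y
    using \<phi> that coset_add[OF H that, symmetric] by simp
  have \<phi>_smult: "\<phi> (H +>\<^bsub>M\<^esub> (a \<odot>\<^bsub>M\<^esub> x)) = a \<otimes>\<^bsub>R\<^esub> \<phi> (H +>\<^bsub>M\<^esub> x)"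
    if "a \<in> carrier R" "x \<in> carrier M" for x a
    using \<phi> that coset_smult[OF H that, symmetric] by simp
  show "(\<lambda>x\<in>carrier M. \<phi> (H +>\<^bsub>M\<^esub> x)) \<in> carrier (dual_space R M)"
    by (auto simp: dual_space_simps[OF R.ring_axioms] \<phi>K \<phi>_add \<phi>_smult)
  show "\<phi> (H +>\<^bsub>M\<^esub> x) = \<zero>\<^bsub>R\<^esub>" if "x \<in> H"
  proof -
    \<comment> \<open>The coset of \<open>x\<close> is that of zero; writing zero as a scalar
      multiple lets homogeneity of \<open>\<phi>\<close> produce the value zero.\<close>
    have "H +>\<^bsub>M\<^esub> x = H +>\<^bsub>M\<^esub> (\<zero>\<^bsub>R\<^esub> \<odot>\<^bsub>M\<^esub> \<zero>\<^bsub>M\<^esub>)"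
      using coset_eq_subspace[OF H] that submodule.zero_closed[OF H] by simp
    then show ?thesis using \<phi>_smult[of "\<zero>\<^bsub>R\<^esub>" "\<zero>\<^bsub>M\<^esub>"] \<phi>K by simp
  qed
qed

lemma dual_quot_space_lift:
  assumes H: "submodule R H M" and g: "g \<in> carrier (dual_space R M)"
    and zero: "\<And>x. x \<in> H \<Longrightarrow> g x = \<zero>\<^bsub>R\<^esub>"
  obtains \<phi> where "\<phi> \<in> carrier (dual_space R (quot_space M H))"
    "\<And>x. x \<in> carrier M \<Longrightarrow> \<phi> (H +>\<^bsub>M\<^esub> x) = g x"
proof -
  interpret abelian_subgroup H M by (rule submodule_abelian_subgroup[OF H])
  note g = g[unfolded dual_space_simps[OF R.ring_axioms]]
  have g_eq: "g x = g y" if "H +>\<^bsub>M\<^esub> x = H +>\<^bsub>M\<^esub> y" "x \<in> carrier M" "y \<in> carrier M" for x y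
  proof -
    have "x \<in> H +>\<^bsub>M\<^esub> y" using a_rcos_self[OF that(2)] that(1) by simp
    then obtain h where h: "h \<in> H" "x = h \<oplus>\<^bsub>M\<^esub> y" by (auto simp: a_r_coset_eq_image)
    then have "h \<in> carrier M" using H by (auto simp: submodule_def)
    then have "g x = g h \<oplus>\<^bsub>R\<^esub> g y" "g y \<in> carrier R" using g h that by auto
    then show ?thesis using zero h by simp
  qed
  \<comment> \<open>The chosen representative is immaterial, since \<open>g\<close> is constant on
    cosets by \<open>g_eq\<close>.\<close>
  define \<phi> where "\<phi> = (\<lambda>X\<in>carrier (quot_space M H). g (SOME x. x \<in> carrier M \<and> X = H +>\<^bsub>M\<^esub> x))"
  have \<phi>: "\<phi> (H +>\<^bsub>M\<^esub> x) = g x" if "x \<in> carrier M" for x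
  proof -
    let ?P = "\<lambda>y. y \<in> carrier M \<and> H +>\<^bsub>M\<^esub> x = H +>\<^bsub>M\<^esub> y"
    have "?P (Eps ?P)" by (rule someI[of ?P x]) (use that in simp)
    then have "g x = g (Eps ?P)" using g_eq[OF _ that] by blast
    moreover have "\<phi> (H +>\<^bsub>M\<^esub> x) = g (Eps ?P)"
      unfolding \<phi>_def by (rule restrict_apply') (use that in \<open>auto simp: carrier_quot_space\<close>)
    ultimately show ?thesis by simp
  qed
  have "\<phi> \<in> carrier (dual_space R (quot_space M H))"
    using g unfolding dual_space_simps[OF R.ring_axioms]
    by (auto simp: \<phi> carrier_quot_space coset_add[OF H] coset_smult[OF H] simp del: restrict_apply)
      (auto simp: \<phi>_def carrier_quot_space)
  then show thesis using that \<phi> by blast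
qed

end


section \<open>Complexes of formal cells and their duals\<close>

lemma reverse_index:
  fixes n i :: nat
  assumes "i \<in> {1..n}"
  shows "n + 1 - i \<in> {1..n}" "n + 1 - (n + 1 - i) = i"
  using assms by auto

text \<open>Swapping the two indices and reversing each of them both flip their order; together they
  preserve it.\<close>

lemma strictly_upper_perp:
  assumes "strictly_upper K n D"
  shows "strictly_upper K n (perp n D)"
  unfolding strictly_upper_def
proof (intro ballI conjI impI)
  fix i j assume ij: "i \<in> {1..n}" "j \<in> {1..n}"
  then show "perp n D i j \<in> carrier K"
    using assms reverse_index(1) unfolding strictly_upper_def perp_def by blast
  assume "j \<le> i"
  then have "n + 1 - i \<le> n + 1 - j" by simp
  then show "perp n D i j = \<zero>\<^bsub>K\<^esub>"
    using assms reverse_index(1) ij unfolding strictly_upper_def perp_def by blast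
qed

lemma finsum_reverse:
  fixes n :: nat
  assumes "abelian_monoid G" "f \<in> {1..n} \<rightarrow> carrier G"
  shows "(\<Oplus>\<^bsub>G\<^esub>i\<in>{1..n}. f (n + 1 - i)) = (\<Oplus>\<^bsub>G\<^esub>i\<in>{1..n}. f i)"
proof -
  interpret abelian_monoid G by (fact assms(1))
  have rev: "(\<lambda>i. n + 1 - i) ` {1..n} = {1..n}"
    using reverse_index by (auto simp only: image_iff) metis
  have "inj_on (\<lambda>i. n + 1 - i) {1..n}" by (auto simp: inj_on_def)
  then show ?thesis
    using add.finprod_reindex[of f "\<lambda>i. n + 1 - i" "{1..n}"] assms(2) unfolding rev by simp
qed

text \<open>Reflection in the antidiagonal reverses matrix products, commutativity of
  \<open>K\<close> swapping the factors back: entry (i, k) of the new square is entry (n+1-k, n+1-i)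
  of the old one.\<close>

lemma boundary_matrix_perp:
  assumes K: "cring K" and D: "boundary_matrix K n D"
  shows "boundary_matrix K n (perp n D)"
proof -
  interpret cring K by (fact K)
  have DK: "D i j \<in> carrier K" if "i \<in> {1..n}" "j \<in> {1..n}" for i j
    using D that by (auto simp: boundary_matrix_def strictly_upper_def)
  have "(\<Oplus>\<^bsub>K\<^esub>j\<in>{1..n}. perp n D i j \<otimes>\<^bsub>K\<^esub> perp n D j k) = \<zero>\<^bsub>K\<^esub>"
    if ik: "i \<in> {1..n}" "k \<in> {1..n}" for i k
  proof -
    have ik': "n + 1 - i \<in> {1..n}" "n + 1 - k \<in> {1..n}" using ik by auto
    have "(\<Oplus>\<^bsub>K\<^esub>j\<in>{1..n}. perp n D i j \<otimes>\<^bsub>K\<^esub> perp n D j k) =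
        (\<Oplus>\<^bsub>K\<^esub>j\<in>{1..n}. D (n + 1 - k) (n + 1 - j) \<otimes>\<^bsub>K\<^esub> D (n + 1 - j) (n + 1 - i))"
      using ik' DK reverse_index(1)[of _ n]
      by (intro finsum_cong') (auto simp: perp_def simp del: One_nat_def atLeastAtMost_iff intro!: m_comm)
    also have "\<dots> = (\<Oplus>\<^bsub>K\<^esub>j\<in>{1..n}. D (n + 1 - k) j \<otimes>\<^bsub>K\<^esub> D j (n + 1 - i))"
      using finsum_reverse[OF abelian_monoid_axioms, of "\<lambda>j. D (n + 1 - k) j \<otimes>\<^bsub>K\<^esub> D j (n + 1 - i)" n] ik' DK by auto
    also have "\<dots> = \<zero>\<^bsub>K\<^esub>" using D ik' by (auto simp: boundary_matrix_def)
    finally show ?thesis .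
  qed
  then show ?thesis using D strictly_upper_perp by (auto simp: boundary_matrix_def)
qed

lemma cell_coordinates_unit_cell:
  assumes "field K"
  shows "cell_coordinates K (ring.func_space K {1..n}) n (unit_cell K n) (\<lambda>i v. v i)"
proof -
  interpret field K by (fact assms)
  note FS = func_space_simps[OF ring_axioms]
  interpret F: module K "func_space {1..n}" by (rule func_space_is_module)
  show ?thesis
  proof unfold_locales
    fix v assume v: "v \<in> carrier (func_space {1..n})"
    let ?s = "\<lambda>i. v i \<odot>\<^bsub>func_space {1..n}\<^esub> unit_cell K n i"
    have vK: "v i \<in> carrier K" if "i \<in> {1..n}" for i using v that by (auto simp: FS)
    have s: "?s \<in> {1..n} \<rightarrow> carrier (func_space {1..n})"
      using vK by (auto simp: FS unit_cell_def)
    have sum: "finsum (func_space {1..n}) ?s {1..n} \<in> carrier (func_space {1..n})"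
      using s by (rule F.finsum_closed)
    show "finsum (func_space {1..n}) ?s {1..n} = v"
    proof (rule PiE_ext[of _ "{1..n}" "\<lambda>_. carrier K"])
      fix k assume k: "k \<in> {1..n}"
      have "finsum (func_space {1..n}) ?s {1..n} k = (\<Oplus>\<^bsub>K\<^esub>i\<in>{1..n}. ?s i k)"
        using k s by (intro additive_finsum[where h = "\<lambda>v. v k"] F.abelian_group_axioms abelian_group_axioms)
          (auto simp: FS)
      also have "\<dots> = (\<Oplus>\<^bsub>K\<^esub>i\<in>{1..n}. if k = i then v i else \<zero>\<^bsub>K\<^esub>)"
        using k vK by (intro finsum_cong') (auto simp: FS unit_cell_def)
      also have "\<dots> = v k"
        using k vK by (intro add.finprod_singleton) auto
      finally show "finsum (func_space {1..n}) ?s {1..n} k = v k" .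
    qed (use sum v in \<open>simp_all add: FS\<close>)
  qed (auto simp: FS unit_cell_def)
qed

section \<open>A complex of formal cells in coordinates\<close>

locale cell_complex = cell_coordinates K V n \<sigma> e
  for K :: "('k, 'r) ring_scheme" and V :: "('k, 'v) module" and n \<sigma> e +
  fixes d :: "'v \<Rightarrow> 'v" and D :: "nat \<Rightarrow> nat \<Rightarrow> 'k"
  assumes d_hom: "d \<in> module_hom K V V"
    and d_d: "x \<in> carrier V \<Longrightarrow> d (d x) = \<zero>\<^bsub>V\<^esub>"
    and upper: "strictly_upper K n D"
    and d_cell: "j \<in> {1..n} \<Longrightarrow> d (\<sigma> j) = (\<Oplus>\<^bsub>V\<^esub>i\<in>{1..<j}. D i j \<odot>\<^bsub>V\<^esub> \<sigma> i)"
begin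

abbreviation "C m \<equiv> cell_span K V \<sigma> m"

abbreviation "F \<equiv> func_space {1..n}"

abbreviation "\<tau> \<equiv> dual_cells K V n \<sigma>"

lemmas dual_simps = dual_space_simps[OF R.ring_axioms]

lemmas FS = func_space_simps[OF R.ring_axioms]

lemma D_closed: "i \<in> {1..n} \<Longrightarrow> j \<in> {1..n} \<Longrightarrow> D i j \<in> carrier K"
  and D_zero: "i \<in> {1..n} \<Longrightarrow> j \<in> {1..n} \<Longrightarrow> j \<le> i \<Longrightarrow> D i j = \<zero>\<^bsub>K\<^esub>"
  using upper by (auto simp: strictly_upper_def)

lemma d_closed: "x \<in> carrier V \<Longrightarrow> d x \<in> carrier V"
  using module_hom_closed[OF d_hom] by auto

lemma coord_d_cell:
  assumes i: "i \<in> {1..n}" and j: "j \<in> {1..n}"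
  shows "e i (d (\<sigma> j)) = D i j"
proof -
  have "d (\<sigma> j) = (\<Oplus>\<^bsub>V\<^esub>i\<in>{1..n}. D i j \<odot>\<^bsub>V\<^esub> \<sigma> i)"
    unfolding d_cell[OF j]
    using j D_closed[OF _ j] D_zero[OF _ j] cell_closed
    by (intro M.add.finprod_mono_neutral_cong_left) auto
  then show ?thesis
    using coord_comb[OF i, of "\<lambda>i. D i j"] D_closed[OF _ j] by simp
qed

lemma coord_d:
  assumes i: "i \<in> {1..n}" and x: "x \<in> carrier V"
  shows "e i (d x) = (\<Oplus>\<^bsub>K\<^esub>j\<in>{1..n}. D i j \<otimes>\<^bsub>K\<^esub> e j x)"
proof -
  \<comment> \<open>A coordinate of the boundary is itself a functional, so row \<open>i\<close> of
    the matrix is just its expansion over the cells.\<close>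
  have "(\<lambda>x\<in>carrier V. e i (d x)) \<in> carrier (dual_space K V)"
    using i by (auto simp: dual_simps d_closed coord_closed coord_add coord_smult
        module_hom_add[OF d_hom] module_hom_smult[OF d_hom])
  from functional_expansion[OF this x]
  have "e i (d x) = (\<Oplus>\<^bsub>K\<^esub>j\<in>{1..n}. e j x \<otimes>\<^bsub>K\<^esub> (\<lambda>x\<in>carrier V. e i (d x)) (\<sigma> j))"
    using x by simp
  also have "\<dots> = (\<Oplus>\<^bsub>K\<^esub>j\<in>{1..n}. D i j \<otimes>\<^bsub>K\<^esub> e j x)"
    using i x D_closed[OF i] coord_closed[OF _ x] cell_closed
    by (intro R.finsum_cong') (auto simp: coord_d_cell R.m_comm)
  finally show ?thesis .
qed

text \<open>The specification of the algorithm asks for a square-zero matrix, while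
  \<open>formal_cells\<close> speaks of the operator. Column \<open>k\<close> of the squared matrix
  lists the coordinates of \<open>d (d (\<sigma> k))\<close>.\<close>

lemma boundary_matrix_D: "boundary_matrix K n D"
  unfolding boundary_matrix_def
proof (intro conjI ballI upper)
  fix i k assume ik: "i \<in> {1..n}" "k \<in> {1..n}"
  have "(\<Oplus>\<^bsub>K\<^esub>j\<in>{1..n}. D i j \<otimes>\<^bsub>K\<^esub> D j k) = (\<Oplus>\<^bsub>K\<^esub>j\<in>{1..n}. D i j \<otimes>\<^bsub>K\<^esub> e j (d (\<sigma> k)))"
    using ik D_closed by (intro R.finsum_cong') (auto simp: coord_d_cell)
  also have "\<dots> = e i (d (d (\<sigma> k)))"
    using ik by (simp add: coord_d d_closed cell_closed del: atLeastAtMost_iff)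
  also have "\<dots> = \<zero>\<^bsub>K\<^esub>"
    using ik by (simp add: d_d coord_zero cell_closed del: atLeastAtMost_iff)
  finally show "(\<Oplus>\<^bsub>K\<^esub>j\<in>{1..n}. D i j \<otimes>\<^bsub>K\<^esub> D j k) = \<zero>\<^bsub>K\<^esub>" .
qed

lemma submodule_C: "m \<le> n \<Longrightarrow> submodule K (C m) V"
  unfolding cell_span_def using cell_closed by (intro span_is_submodule) auto

lemma d_C:
  assumes m: "m \<le> n"
  shows "d ` C m \<subseteq> C m"
proof clarify
  fix x assume "x \<in> C m"
  then have x: "x \<in> carrier V" "\<And>j. j \<in> {1..n} \<Longrightarrow> m < j \<Longrightarrow> e j x = \<zero>\<^bsub>K\<^esub>"
    using cell_span_iff[OF m] by auto
  have "e i (d x) = \<zero>\<^bsub>K\<^esub>" if i: "i \<in> {1..n}" "m < i" for i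
  proof -
    \<comment> \<open>For \<open>j\<close> above \<open>m\<close> the coordinate of \<open>x\<close>
      vanishes; for \<open>j\<close> up to \<open>m\<close>, hence below \<open>i\<close>, the
      matrix entry vanishes by triangularity.\<close>
    have "D i j \<otimes>\<^bsub>K\<^esub> e j x = \<zero>\<^bsub>K\<^esub>" if j: "j \<in> {1..n}" for j
      using x D_zero[OF i(1) j] D_closed[OF i(1) j] coord_closed[OF j x(1)] i j
      by (cases "m < j") auto
    then show ?thesis
      using i x by (simp add: coord_d R.finsum_all0 del: atLeastAtMost_iff)
  qed
  then show "d x \<in> C m" using cell_span_iff[OF m] d_closed x by auto
qed

section \<open>The dual basis as a sequence of formal cells\<close>

lemma dual_cell_eq:
  assumes i: "i \<in> {1..n}"
  shows "\<tau> i = (\<lambda>x\<in>carrier V. e (n + 1 - i) x)"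
proof -
  let ?f = "\<lambda>x\<in>carrier V. e (n + 1 - i) x"
  note i' = reverse_index(1)[OF i]
  have f: "?f \<in> carrier (dual_space K V)"
    using i' by (auto simp: dual_simps coord_closed coord_add coord_smult simp del: atLeastAtMost_iff)
  have f\<sigma>: "?f (\<sigma> j) = (if j = n + 1 - i then \<one>\<^bsub>K\<^esub> else \<zero>\<^bsub>K\<^esub>)" if "j \<in> {1..n}" for j
    using that i' cell_closed[OF that] coord_cell[OF i' that] by auto
  show ?thesis
    unfolding dual_cells_def dual_basis_def
    \<comment> \<open>Uniqueness in the definite description: a functional is determined by its
      values on the cells.\<close>
    by (rule the_equality) (use f f\<sigma> functional_eqI in auto)
qed

lemma vectorspace_dual: "vectorspace K (dual_space K V)"
  using module_dual_space[OF R.is_cring, of V] by (simp add: vectorspace_def field_axioms)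

text \<open>Biduality in coordinates: as \<open>\<tau> i\<close> is dual to the cell of index n+1-i,
  its coefficient in a functional is the value at that cell.\<close>

lemma dual_coordinates: "cell_coordinates K (dual_space K V) n \<tau> (\<lambda>i f. f (\<sigma> (n + 1 - i)))"
proof -
  interpret dual: vectorspace K "dual_space K V" by (rule vectorspace_dual)
  note rev = reverse_index[of _ n]
  have \<tau>: "\<tau> i \<in> carrier (dual_space K V)" if "i \<in> {1..n}" for i
    using rev(1)[OF that]
    by (auto simp: dual_cell_eq[OF that] dual_simps coord_closed coord_add coord_smult simp del: atLeastAtMost_iff)
  have \<sigma>: "\<sigma> (n + 1 - i) \<in> carrier V" if "i \<in> {1..n}" for i
    using cell_closed[OF rev(1)[OF that]] .
  have \<tau>\<sigma>: "\<tau> i (\<sigma> k) = (if n + 1 - i = k then \<one>\<^bsub>K\<^esub> else \<zero>\<^bsub>K\<^esub>)" if "i \<in> {1..n}" "k \<in> {1..n}" for i k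
    using coord_cell[OF rev(1)[OF that(1)] that(2)] cell_closed[OF that(2)] by (simp add: dual_cell_eq[OF that(1)])
  show ?thesis
  proof unfold_locales
    fix f assume f: "f \<in> carrier (dual_space K V)"
    let ?s = "\<lambda>i. f (\<sigma> (n + 1 - i)) \<odot>\<^bsub>dual_space K V\<^esub> \<tau> i"
    have fK: "f x \<in> carrier K" if "x \<in> carrier V" for x using f that by (auto simp: dual_simps)
    have s: "?s \<in> {1..n} \<rightarrow> carrier (dual_space K V)"
      using fK \<sigma> \<tau> by auto
    show "(\<Oplus>\<^bsub>dual_space K V\<^esub>i\<in>{1..n}. ?s i) = f"
    \<comment> \<open>The expansion is tested on each cell \<open>\<sigma> k\<close>, where only the
      term with index n+1-k survives.\<close>
    proof (rule functional_eqI)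
      fix k assume k: "k \<in> {1..n}"
      note \<sigma>k = cell_closed[OF k]
      have "(\<Oplus>\<^bsub>dual_space K V\<^esub>i\<in>{1..n}. ?s i) (\<sigma> k) = (\<Oplus>\<^bsub>K\<^esub>i\<in>{1..n}. ?s i (\<sigma> k))"
        using s \<sigma>k
        by (intro additive_finsum[where h = "\<lambda>f. f (\<sigma> k)"] dual.M.abelian_group_axioms R.abelian_group_axioms)
          (auto simp: dual_simps)
      also have "\<dots> = (\<Oplus>\<^bsub>K\<^esub>i\<in>{1..n}. if n + 1 - k = i then f (\<sigma> (n + 1 - i)) else \<zero>\<^bsub>K\<^esub>)"
      proof (rule R.finsum_cong')
        fix i assume i: "i \<in> {1..n}"
        have "n + 1 - i = k \<longleftrightarrow> n + 1 - k = i" using i k by auto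
        then show "?s i (\<sigma> k) = (if n + 1 - k = i then f (\<sigma> (n + 1 - i)) else \<zero>\<^bsub>K\<^esub>)"
          using \<sigma>k fK[OF \<sigma>[OF i]] by (simp add: dual_simps \<tau>\<sigma>[OF i k])
      qed (use fK \<sigma> in auto)
      also have "\<dots> = f (\<sigma> (n + 1 - (n + 1 - k)))"
        using rev(1)[OF k] fK \<sigma> by (intro R.add.finprod_singleton) auto
      finally show "(\<Oplus>\<^bsub>dual_space K V\<^esub>i\<in>{1..n}. ?s i) (\<sigma> k) = f (\<sigma> k)"
        using rev(2)[OF k] by simp
    qed (use s f in \<open>auto intro: dual.M.finsum_closed\<close>)
  next
    fix i j assume ij: "i \<in> {1..n}" "j \<in> {1..n}"
    have "n + 1 - j = n + 1 - i \<longleftrightarrow> i = j" using ij by auto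
    then show "\<tau> j (\<sigma> (n + 1 - i)) = (if i = j then \<one>\<^bsub>K\<^esub> else \<zero>\<^bsub>K\<^esub>)"
      using \<tau>\<sigma>[OF ij(2) rev(1)[OF ij(1)]] by simp
  next
    fix i assume i: "i \<in> {1..n}"
    show "\<tau> i \<in> carrier (dual_space K V)" by (rule \<tau>[OF i])
    show "f (\<sigma> (n + 1 - i)) \<in> carrier K" if "f \<in> carrier (dual_space K V)" for f
      using that \<sigma>[OF i] by (auto simp: dual_simps)
    show "(f \<oplus>\<^bsub>dual_space K V\<^esub> g) (\<sigma> (n + 1 - i)) = f (\<sigma> (n + 1 - i)) \<oplus>\<^bsub>K\<^esub> g (\<sigma> (n + 1 - i))" for f g
      using \<sigma>[OF i] by (simp add: dual_simps)
    show "(a \<odot>\<^bsub>dual_space K V\<^esub> f) (\<sigma> (n + 1 - i)) = a \<otimes>\<^bsub>K\<^esub> f (\<sigma> (n + 1 - i))" for a f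
      using \<sigma>[OF i] by (simp add: dual_simps)
  qed
qed

text \<open>The coefficient of \<open>\<tau> i\<close> in the coboundary of \<open>\<tau> j\<close>
  is the value of \<open>\<tau> j\<close> at the boundary of the cell of index n+1-i, that is, the
  entry of \<open>D\<close> in row n+1-j and column n+1-i.\<close>

lemma dual_formal_cells: "formal_cells K (dual_space K V) n \<tau> (dual_map V d) (perp n D)"
proof -
  interpret dual: cell_coordinates K "dual_space K V" n \<tau> "\<lambda>i f. f (\<sigma> (n + 1 - i))"
    by (rule dual_coordinates)
  have delta: "dual_map V d f \<in> carrier (dual_space K V)" if "f \<in> carrier (dual_space K V)" for f
    using that by (auto simp: dual_simps dual_map_def d_closed module_hom_add[OF d_hom] module_hom_smult[OF d_hom])
  \<comment> \<open>Turns the square-zero property of \<open>d\<close> into that of its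
    adjoint.\<close>
  have fd0: "f \<zero>\<^bsub>V\<^esub> = \<zero>\<^bsub>K\<^esub>" if "f \<in> carrier (dual_space K V)" for f
  proof -
    have "f (\<zero>\<^bsub>K\<^esub> \<odot>\<^bsub>V\<^esub> \<zero>\<^bsub>V\<^esub>) = \<zero>\<^bsub>K\<^esub> \<otimes>\<^bsub>K\<^esub> f \<zero>\<^bsub>V\<^esub>" "f \<zero>\<^bsub>V\<^esub> \<in> carrier K"
      using that M.zero_closed R.zero_closed unfolding dual_simps by blast+
    then show ?thesis by simp
  qed
  have cell: "dual_map V d (\<tau> j) = (\<Oplus>\<^bsub>dual_space K V\<^esub>i\<in>{1..<j}. perp n D i j \<odot>\<^bsub>dual_space K V\<^esub> \<tau> i)"
    if j: "j \<in> {1..n}" for j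
  proof -
    have p: "perp n D i j \<in> carrier K" if "i \<in> {1..n}" for i
      using strictly_upper_perp[OF upper] that j by (auto simp: strictly_upper_def)
    have p0: "perp n D i j = \<zero>\<^bsub>K\<^esub>" if "i \<in> {1..n}" "j \<le> i" for i
      using strictly_upper_perp[OF upper] that j by (auto simp: strictly_upper_def)
    have "(\<Oplus>\<^bsub>dual_space K V\<^esub>i\<in>{1..<j}. perp n D i j \<odot>\<^bsub>dual_space K V\<^esub> \<tau> i) =
        (\<Oplus>\<^bsub>dual_space K V\<^esub>i\<in>{1..n}. perp n D i j \<odot>\<^bsub>dual_space K V\<^esub> \<tau> i)"
      using j p p0 dual.cell_closed
      by (intro dual.M.add.finprod_mono_neutral_cong_left) auto
    also have "\<dots> = dual_map V d (\<tau> j)"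
    proof (rule dual.coord_eqI)
      have s: "(\<lambda>i. perp n D i j \<odot>\<^bsub>dual_space K V\<^esub> \<tau> i) \<in> {1..n} \<rightarrow> carrier (dual_space K V)"
        using p dual.cell_closed by auto
      show "(\<Oplus>\<^bsub>dual_space K V\<^esub>i\<in>{1..n}. perp n D i j \<odot>\<^bsub>dual_space K V\<^esub> \<tau> i) \<in> carrier (dual_space K V)"
        by (rule dual.M.finsum_closed[OF s])
      show "dual_map V d (\<tau> j) \<in> carrier (dual_space K V)"
        by (rule delta[OF dual.cell_closed[OF j]])
      fix i assume i: "i \<in> {1..n}"
      note i' = reverse_index(1)[OF i] and j' = reverse_index(1)[OF j]
      have "dual_map V d (\<tau> j) (\<sigma> (n + 1 - i)) = perp n D i j"
        using cell_closed[OF i'] coord_d_cell[OF j' i']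
        by (simp add: dual_map_def dual_cell_eq[OF j] d_closed perp_def)
      then show "(\<Oplus>\<^bsub>dual_space K V\<^esub>i\<in>{1..n}. perp n D i j \<odot>\<^bsub>dual_space K V\<^esub> \<tau> i) (\<sigma> (n + 1 - i)) =
          dual_map V d (\<tau> j) (\<sigma> (n + 1 - i))"
        using dual.coord_comb[OF i, of "\<lambda>i. perp n D i j"] p by simp
    qed
    finally show ?thesis by simp
  qed
  show ?thesis
    unfolding formal_cells_def
  proof (intro conjI ballI)
    show "dual_map V d \<in> module_hom K (dual_space K V) (dual_space K V)"
      by (intro module_homI) (auto simp: delta, auto simp: dual_map_def dual_simps d_closed)
    show "dual_map V d (dual_map V d f) = \<zero>\<^bsub>dual_space K V\<^esub>" if "f \<in> carrier (dual_space K V)" for f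
      using fd0[OF that] by (auto simp: dual_map_def dual_simps d_closed d_d)
  qed (use vectorspace_dual dual.inj_cells dual.basis_cells strictly_upper_perp[OF upper] cell in auto)
qed

text \<open>The reversal \<open>n + 1 - k\<close> makes vanishing on the first \<open>m\<close> cells vanishing of the last \<open>m\<close>
  coordinates.\<close>

definition coords :: "nat \<Rightarrow> ('v set \<Rightarrow> 'k) \<Rightarrow> nat \<Rightarrow> 'k" where
  "coords m \<phi> = (\<lambda>k\<in>{1..n}. \<phi> (C m +>\<^bsub>V\<^esub> \<sigma> (n + 1 - k)))"

text \<open>The quotient by \<open>C m\<close> has dimension \<open>n - m\<close> when
  \<open>m\<close> is at most \<open>n\<close>, hence the step \<open>n - m\<close> of the
  filtration that the algorithm sees.\<close>

abbreviation "W m \<equiv> F\<lparr>carrier := cell_span K F (unit_cell K n) (n - m)\<rparr>"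

lemma carrier_W:
  "carrier (W m) = {v \<in> {1..n} \<rightarrow>\<^sub>E carrier K. \<forall>k\<in>{1..n}. n - m < k \<longrightarrow> v k = \<zero>\<^bsub>K\<^esub>}"
  using cell_coordinates.cell_span_iff[OF cell_coordinates_unit_cell[OF field_axioms], of "n - m" n]
  by (auto simp: FS)

lemma module_W: "module K (W m)"
proof -
  interpret unit: cell_coordinates K F n "unit_cell K n" "\<lambda>i v. v i"
    by (rule cell_coordinates_unit_cell[OF field_axioms])
  show ?thesis
    unfolding cell_span_def using unit.cell_closed
    by (intro unit.submodule_is_module unit.span_is_submodule) auto
qed

lemma pullback:
  assumes m: "m \<le> n" and \<phi>: "\<phi> \<in> carrier (rel_cochains K V \<sigma> m)"
  shows "(\<lambda>x\<in>carrier V. \<phi> (C m +>\<^bsub>V\<^esub> x)) \<in> carrier (dual_space K V)"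
    "x \<in> C m \<Longrightarrow> \<phi> (C m +>\<^bsub>V\<^esub> x) = \<zero>\<^bsub>K\<^esub>"
    "x \<in> carrier V \<Longrightarrow> \<phi> (C m +>\<^bsub>V\<^esub> x) \<in> carrier K"
  using dual_quot_space_pullback[OF submodule_C[OF m] \<phi>[unfolded rel_cochains_def]] \<phi>
  by (auto simp: rel_cochains_def dual_simps carrier_quot_space)

lemma cell_coset_closed: "i \<in> {1..n} \<Longrightarrow> C m +>\<^bsub>V\<^esub> \<sigma> i \<in> carrier (quot_space V (C m))"
  using cell_closed by (auto simp: carrier_quot_space)

text \<open>A cochain is determined by its values on cells. Conversely, admissible values define a
  functional that vanishes on \<open>C m\<close> and so descends to the quotient.\<close>

lemma linear_iso_coords:
  assumes m: "m \<le> n"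
  shows "linear_iso K (rel_cochains K V \<sigma> m) (W m) (coords m)"
  unfolding linear_iso_def bij_betw_def
proof (intro conjI module_homI)
  note rev = reverse_index[of _ n]
  \<comment> \<open>For \<open>k\<close> beyond \<open>n - m\<close> the reversed index n+1-k is at
    most \<open>m\<close>; hence the last \<open>m\<close> entries of \<open>coords m \<phi>\<close>
    vanish.\<close>
  have \<sigma>C: "\<sigma> (n + 1 - k) \<in> C m" if "k \<in> {1..n}" "n - m < k" for k
    using that m cell_span_iff[OF m] cell_closed[OF rev(1)[OF that(1)]] coord_cell[OF _ rev(1)[OF that(1)]]
    by auto
  have coords_W: "coords m \<phi> \<in> carrier (W m)" if \<phi>: "\<phi> \<in> carrier (rel_cochains K V \<sigma> m)" for \<phi>
    unfolding carrier_W using pullback[OF m \<phi>] \<sigma>C cell_closed[OF rev(1)]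
    by (auto simp: coords_def)
  then show "coords m \<in> carrier (rel_cochains K V \<sigma> m) \<rightarrow> carrier (W m)" by auto
  show "coords m (\<phi> \<oplus>\<^bsub>rel_cochains K V \<sigma> m\<^esub> \<psi>) = coords m \<phi> \<oplus>\<^bsub>W m\<^esub> coords m \<psi>" for \<phi> \<psi>
    using cell_coset_closed[OF rev(1)]
    by (auto simp: coords_def rel_cochains_def dual_simps FS fun_eq_iff)
  show "coords m (a \<odot>\<^bsub>rel_cochains K V \<sigma> m\<^esub> \<phi>) = a \<odot>\<^bsub>W m\<^esub> coords m \<phi>" for a \<phi>
    using cell_coset_closed[OF rev(1)]
    by (auto simp: coords_def rel_cochains_def dual_simps FS fun_eq_iff)
  show "inj_on (coords m) (carrier (rel_cochains K V \<sigma> m))"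
  proof (rule inj_onI)
    fix \<phi> \<psi>
    assume \<phi>: "\<phi> \<in> carrier (rel_cochains K V \<sigma> m)" and \<psi>: "\<psi> \<in> carrier (rel_cochains K V \<sigma> m)"
      and eq: "coords m \<phi> = coords m \<psi>"
    have "\<phi> (C m +>\<^bsub>V\<^esub> \<sigma> i) = \<psi> (C m +>\<^bsub>V\<^esub> \<sigma> i)" if "i \<in> {1..n}" for i
      using fun_cong[OF eq, of "n + 1 - i"] rev[OF that] by (simp add: coords_def del: atLeastAtMost_iff)
    then have "(\<lambda>x\<in>carrier V. \<phi> (C m +>\<^bsub>V\<^esub> x)) = (\<lambda>x\<in>carrier V. \<psi> (C m +>\<^bsub>V\<^esub> x))"
      using cell_closed by (intro functional_eqI pullback(1)[OF m] \<phi> \<psi>) auto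
    from fun_cong[OF this]
    have "\<phi> (C m +>\<^bsub>V\<^esub> x) = \<psi> (C m +>\<^bsub>V\<^esub> x)" if "x \<in> carrier V" for x
      using that by (auto dest: meta_spec[of _ x])
    then show "\<phi> = \<psi>"
      using \<phi> \<psi> unfolding rel_cochains_def dual_simps carrier_quot_space
      by (intro PiE_ext[of \<phi> "(+>\<^bsub>V\<^esub>) (C m) ` carrier V" "\<lambda>_. carrier K" \<psi>]) auto
  qed
  show "coords m ` carrier (rel_cochains K V \<sigma> m) = carrier (W m)"
  proof (intro equalityI subsetI)
    fix v assume v: "v \<in> carrier (W m)"
    then have vK: "v \<in> {1..n} \<rightarrow>\<^sub>E carrier K"
      and v0: "\<And>k. k \<in> {1..n} \<Longrightarrow> n - m < k \<Longrightarrow> v k = \<zero>\<^bsub>K\<^esub>"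
      unfolding carrier_W by auto
    have c: "(\<lambda>i. v (n + 1 - i)) \<in> {1..n} \<rightarrow> carrier K" using vK rev(1) by auto
    obtain g where g: "g \<in> carrier (dual_space K V)"
        "\<And>i. i \<in> {1..n} \<Longrightarrow> g (\<sigma> i) = v (n + 1 - i)"
        "\<And>x. x \<in> carrier V \<Longrightarrow> g x = (\<Oplus>\<^bsub>K\<^esub>i\<in>{1..n}. e i x \<otimes>\<^bsub>K\<^esub> v (n + 1 - i))"
      by (rule functional_exists[OF c that])
    have g0: "g x = \<zero>\<^bsub>K\<^esub>" if x: "x \<in> C m" for x
    proof -
      have xV: "x \<in> carrier V" and x0: "\<And>i. i \<in> {1..n} \<Longrightarrow> m < i \<Longrightarrow> e i x = \<zero>\<^bsub>K\<^esub>"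
        using x cell_span_iff[OF m] by auto
      \<comment> \<open>Each factor covers the range that the other leaves open: the coordinates of
        \<open>x\<close> vanish beyond \<open>m\<close>, and the reversed entries of
        \<open>v\<close> vanish up to \<open>m\<close>.\<close>
      have "e i x \<otimes>\<^bsub>K\<^esub> v (n + 1 - i) = \<zero>\<^bsub>K\<^esub>" if i: "i \<in> {1..n}" for i
      proof (cases "m < i")
        case True
        then show ?thesis using x0[OF i True] funcset_mem[OF c i] by simp
      next
        case False
        then have "n - m < n + 1 - i" using i m by auto
        then show ?thesis using v0[OF rev(1)[OF i]] coord_closed[OF i xV] by simp
      qed
      then show ?thesis using g(3)[OF xV] by (simp add: R.finsum_all0 del: atLeastAtMost_iff)
    qed
    obtain \<phi> where
      \<phi>: "\<phi> \<in> carrier (dual_space K (quot_space V (C m)))" "\<And>x. x \<in> carrier V \<Longrightarrow> \<phi> (C m +>\<^bsub>V\<^esub> x) = g x"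
      by (rule dual_quot_space_lift[OF submodule_C[OF m] g(1) g0 that])
    have "coords m \<phi> = v"
    proof (rule PiE_ext[of _ "{1..n}" "\<lambda>_. carrier K"])
      show "coords m \<phi> \<in> {1..n} \<rightarrow>\<^sub>E carrier K"
        using coords_W[of \<phi>] \<phi>(1) unfolding carrier_W by (simp add: rel_cochains_def)
      show "coords m \<phi> k = v k" if "k \<in> {1..n}" for k
        using that cell_closed[OF rev(1)[OF that]] g(2)[OF rev(1)[OF that]] rev(2)[OF that]
        by (simp add: coords_def \<phi>(2) del: atLeastAtMost_iff)
    qed (rule vK)
    then show "v \<in> coords m ` carrier (rel_cochains K V \<sigma> m)"
      using \<phi>(1) by (auto simp: rel_cochains_def)
  qed (use coords_W in auto)
qed

lemma coset_map_d:
  assumes "m \<le> n" "x \<in> carrier V"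
  shows "coset_map V (C m) d (C m +>\<^bsub>V\<^esub> x) = C m +>\<^bsub>V\<^esub> d x"
  using assms by (intro coset_map_coset submodule_C d_C) (auto simp: d_closed module_hom_add[OF d_hom])

lemma rel_coboundary_closed:
  assumes m: "m \<le> n" and \<phi>: "\<phi> \<in> carrier (rel_cochains K V \<sigma> m)"
  shows "rel_coboundary K V \<sigma> d m \<phi> \<in> carrier (rel_cochains K V \<sigma> m)"
  using \<phi> submodule_C[OF m]
  by (auto simp: rel_coboundary_def rel_cochains_def dual_simps dual_map_def carrier_quot_space
      coset_add coset_smult coset_map_d[OF m] d_closed module_hom_add[OF d_hom] module_hom_smult[OF d_hom])

text \<open>Entry \<open>k\<close> of the coboundary is the functional at the boundary of the cell
  of index n+1-k. Expanding that boundary gives column n+1-k of \<open>D\<close>, and reversing the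
  order of summation turns this column into row \<open>k\<close> of \<open>perp n D\<close>.\<close>

lemma chain_iso_coords:
  assumes m: "m \<le> n"
  shows "chain_iso K (rel_cochains K V \<sigma> m) (W m) (rel_coboundary K V \<sigma> d m)
    (matrix_map K n (perp n D)) (coords m)"
proof -
  interpret rel: module K "rel_cochains K V \<sigma> m"
    unfolding rel_cochains_def by (rule module_dual_quot_space[OF submodule_C[OF m]])
  interpret W: module K "W m" by (rule module_W)
  note rev = reverse_index[of _ n]
  show ?thesis
  proof unfold_locales
    fix \<phi> assume \<phi>: "\<phi> \<in> carrier (rel_cochains K V \<sigma> m)"
    show "coords m (rel_coboundary K V \<sigma> d m \<phi>) = matrix_map K n (perp n D) (coords m \<phi>)"
    proof
      fix k
      show "coords m (rel_coboundary K V \<sigma> d m \<phi>) k = matrix_map K n (perp n D) (coords m \<phi>) k"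
      proof (cases "k \<in> {1..n}")
        case True
        note k = True and k' = rev(1)[OF True]
        define g where "g = (\<lambda>x\<in>carrier V. \<phi> (C m +>\<^bsub>V\<^esub> x))"
        have g: "g \<in> carrier (dual_space K V)" unfolding g_def by (rule pullback(1)[OF m \<phi>])
        have gK: "g (\<sigma> i) \<in> carrier K" if "i \<in> {1..n}" for i
          using g cell_closed[OF that] by (auto simp: dual_simps)
        have "coords m (rel_coboundary K V \<sigma> d m \<phi>) k = g (d (\<sigma> (n + 1 - k)))"
          using k cell_coset_closed[OF k'] cell_closed[OF k']
          by (simp add: coords_def rel_coboundary_def dual_map_def coset_map_d[OF m] g_def d_closed
              del: atLeastAtMost_iff)
        also have "\<dots> = (\<Oplus>\<^bsub>K\<^esub>i\<in>{1..n}. e i (d (\<sigma> (n + 1 - k))) \<otimes>\<^bsub>K\<^esub> g (\<sigma> i))"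
          by (rule functional_expansion[OF g d_closed[OF cell_closed[OF k']]])
        also have "\<dots> = (\<Oplus>\<^bsub>K\<^esub>i\<in>{1..n}. D i (n + 1 - k) \<otimes>\<^bsub>K\<^esub> g (\<sigma> i))"
          using gK D_closed[OF _ k'] coord_d_cell[OF _ k'] by (intro R.finsum_cong') auto
        also have "\<dots> = (\<Oplus>\<^bsub>K\<^esub>j\<in>{1..n}. D (n + 1 - j) (n + 1 - k) \<otimes>\<^bsub>K\<^esub> g (\<sigma> (n + 1 - j)))"
          using gK D_closed[OF _ k']
          by (intro finsum_reverse[symmetric, OF R.abelian_monoid_axioms,
                of "\<lambda>i. D i (n + 1 - k) \<otimes>\<^bsub>K\<^esub> g (\<sigma> i)"]) auto
        also have "\<dots> = (\<Oplus>\<^bsub>K\<^esub>j\<in>{1..n}. perp n D k j \<otimes>\<^bsub>K\<^esub> coords m \<phi> j)"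
          using gK[OF rev(1)] D_closed[OF rev(1) k'] cell_closed[OF rev(1)]
          by (intro R.finsum_cong') (simp_all add: perp_def coords_def g_def Pi_iff del: atLeastAtMost_iff)
        finally show ?thesis using k by (simp add: matrix_map_def)
      next
        case False
        then show ?thesis by (simp add: coords_def matrix_map_def del: atLeastAtMost_iff)
      qed
    qed
  qed (use linear_iso_coords[OF m] rel_coboundary_closed[OF m] in auto)
qed

section \<open>The arrows, and the comparison of the two persistence modules\<close>

lemma C_mono: "i \<le> j \<Longrightarrow> j \<le> n \<Longrightarrow> C i \<subseteq> C j"
  using cell_span_iff[of i] cell_span_iff[of j] by auto

lemma coset_map_id:
  assumes "i \<le> j" "j \<le> n" "x \<in> carrier V"
  shows "coset_map V (C j) (\<lambda>x. x) (C i +>\<^bsub>V\<^esub> x) = C j +>\<^bsub>V\<^esub> x"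
  using assms C_mono[OF assms(1,2)] by (intro coset_map_coset submodule_C) auto

text \<open>Directed away from the matrix side so that it composes with the isomorphism specified
  for the algorithm; hence the maps are inverses of \<open>coords\<close>.\<close>

lemma persistent_homology_iso:
  "pmod_iso K {1..n} (forward {1..n})
    (persistent_homology K F (unit_cell K n) (matrix_map K n (perp n D)))
    (reindex (\<lambda>i. n - i) (relative_cohomology K V \<sigma> d))"
proof -
  define proj where "proj i j = dual_map (quot_space V (C i)) (coset_map V (C j) (\<lambda>x. x))" for i j
  define f where "f i = inv_into (carrier (rel_cochains K V \<sigma> (n - i))) (coords (n - i))" for i
  have proj: "proj i j \<phi> \<in> carrier (rel_cochains K V \<sigma> i)" "coords i (proj i j \<phi>) = coords j \<phi>"
    if ij: "i \<le> j" "j \<le> n" and \<phi>: "\<phi> \<in> carrier (rel_cochains K V \<sigma> j)" for i j \<phi>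
  proof -
    have "i \<le> n" using ij by simp
    note C = submodule_C[OF this] submodule_C[OF ij(2)]
    show "proj i j \<phi> \<in> carrier (rel_cochains K V \<sigma> i)"
      using \<phi> C
      by (auto simp: proj_def rel_cochains_def dual_simps dual_map_def carrier_quot_space
          coset_add coset_smult coset_map_id[OF ij])
    \<comment> \<open>The projection sends the coset of a cell to the coset of the same cell, so the
      listed values do not change. This is what makes the arrow an inclusion in coordinates.\<close>
    show "coords i (proj i j \<phi>) = coords j \<phi>"
      using cell_coset_closed[OF reverse_index(1)] cell_closed[OF reverse_index(1)]
      by (auto simp: coords_def proj_def dual_map_def coset_map_id[OF ij] fun_eq_iff)
  qed
  have chain: "chain_iso K (F\<lparr>carrier := cell_span K F (unit_cell K n) i\<rparr>) (rel_cochains K V \<sigma> (n - i))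
      (matrix_map K n (perp n D)) (rel_coboundary K V \<sigma> d (n - i)) (f i)" if "i \<in> {1..n}" for i
    using chain_iso_inv[OF chain_iso_coords[of "n - i"]] that by (simp add: f_def)
  have "pmod_iso K {1..n} (forward {1..n})
    \<lparr>space = (\<lambda>i. homology (F\<lparr>carrier := cell_span K F (unit_cell K n) i\<rparr>) (matrix_map K n (perp n D))),
     arrow = (\<lambda>i j. coset_map (F\<lparr>carrier := cell_span K F (unit_cell K n) j\<rparr>)
       (matrix_map K n (perp n D) ` carrier (F\<lparr>carrier := cell_span K F (unit_cell K n) j\<rparr>)) (\<lambda>x. x))\<rparr>
    \<lparr>space = (\<lambda>i. homology (rel_cochains K V \<sigma> (n - i)) (rel_coboundary K V \<sigma> d (n - i))),
     arrow = (\<lambda>i j. coset_map (rel_cochains K V \<sigma> (n - j))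
       (rel_coboundary K V \<sigma> d (n - j) ` carrier (rel_cochains K V \<sigma> (n - j))) (proj (n - j) (n - i)))\<rparr>"
  proof (rule pmod_iso_homology)
    fix i j v
    assume "(i, j) \<in> forward {1..n}" and v: "v \<in> carrier (F\<lparr>carrier := cell_span K F (unit_cell K n) i\<rparr>)"
    then have ij: "i \<in> {1..n}" "j \<in> {1..n}" "j = Suc i" by (auto simp: forward_def)
    have sub: "carrier (W (n - i)) \<subseteq> carrier (W (n - j))"
      unfolding carrier_W using ij by auto
    have vW: "v \<in> carrier (W (n - i))" using v ij by simp
    then show "v \<in> carrier (F\<lparr>carrier := cell_span K F (unit_cell K n) j\<rparr>)"
      using subsetD[OF sub vW] ij by simp
    have iso: "bij_betw (coords (n - k)) (carrier (rel_cochains K V \<sigma> (n - k))) (carrier (W (n - k)))" for k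
      using linear_iso_coords[of "n - k"] by (simp add: linear_iso_def)
    have f: "f i v \<in> carrier (rel_cochains K V \<sigma> (n - i))" "coords (n - i) (f i v) = v"
    proof -
      have "v \<in> coords (n - i) ` carrier (rel_cochains K V \<sigma> (n - i))"
        using iso[of i] vW unfolding bij_betw_def by blast
      then show "f i v \<in> carrier (rel_cochains K V \<sigma> (n - i))" "coords (n - i) (f i v) = v"
        unfolding f_def by (rule inv_into_into, rule f_inv_into_f)
    qed
    \<comment> \<open>Naturality of the inverse is naturality of \<open>coords\<close> with both
      vectors pulled back: \<open>v\<close> is the list of values of either cochain.\<close>
    have "f j (coords (n - j) (proj (n - j) (n - i) (f i v))) = proj (n - j) (n - i) (f i v)"
      using iso[of j] proj(1)[OF _ _ f(1), of "n - j"] ij unfolding f_def[of j] bij_betw_def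
      by (intro inv_into_f_f) auto
    then show "f j v = proj (n - j) (n - i) (f i v)"
      using proj(2)[OF _ _ f(1), of "n - j"] f(2) ij by simp
  qed (use chain in \<open>auto simp: forward_def\<close>)
  \<comment> \<open>The two forms of the arrow on the matrix side use records with different
    carriers; their cosets agree because only the addition matters.\<close>
  then show ?thesis
    by (simp add: persistent_homology_def reindex_def relative_cohomology_def proj_def coset_map_def[abs_def]
        a_r_coset_eq_image)
qed

end

section \<open>Transfer to the output of the algorithm and to its barcode\<close>

theorem corollary2p7:
  fixes K :: "('k, 'r) ring_scheme"
    and V :: "('k, 'v) module"
    and n :: nat
    and \<sigma> :: "nat \<Rightarrow> 'v"
    and d :: "'v \<Rightarrow> 'v"
    and D :: "nat \<Rightarrow> nat \<Rightarrow> 'k"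
    and A :: "nat \<Rightarrow> (nat \<Rightarrow> nat \<Rightarrow> 'k) \<Rightarrow> ('k, 'w) pmod"
  assumes "field K"
    and "1 \<le> n"
    and "formal_cells K V n \<sigma> d D"
    and "computes_persistent_homology K A"
  shows "formal_cells K (dual_space K V) n (dual_cells K V n \<sigma>) (dual_map V d) (perp n D) \<and>
    pmod_iso K {1..n} (forward {1..n})
      (A n (perp n D)) (reindex (\<lambda>i. n - i) (relative_cohomology K V \<sigma> d)) \<and>
    (\<forall>M. has_barcode K {1..n} (forward {1..n}) (A n (perp n D)) M \<longrightarrow>
      has_barcode K {0..<n} (backward {0..<n}) (relative_cohomology K V \<sigma> d)
        (image_mset (\<lambda>(a, b). (n - b, n - a)) M))"
proof -
  interpret vectorspace K V
    using assms(3) by (simp add: formal_cells_def)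
  obtain e where "cell_coordinates K V n \<sigma> e"
    using assms(3) obtain_cell_coordinates[of \<sigma> n thesis] by (simp add: formal_cells_def)
  then interpret cell_complex K V n \<sigma> e d D
    using assms(3) by (simp add: cell_complex_def cell_complex_axioms_def formal_cells_def)
  let ?I = "{1..n}" and ?J = "{0..<n}"
  have E: "forward ?I \<subseteq> ?I \<times> ?I" and F: "backward ?J \<subseteq> ?J \<times> ?J"
    by (auto simp: forward_def backward_def)
  \<comment> \<open>The specification is used at the reflected matrix, which is admissible because
    its square vanishes too.\<close>
  have A: "persistence_module K ?I (forward ?I) (A n (perp n D))"
    "pmod_iso K ?I (forward ?I) (A n (perp n D))
      (persistent_homology K F (unit_cell K n) (matrix_map K n (perp n D)))"
    using assms(2,4) boundary_matrix_perp[OF R.is_cring boundary_matrix_D]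
    unfolding computes_persistent_homology_def by blast+
  have iso: "pmod_iso K ?I (forward ?I) (A n (perp n D)) (reindex (\<lambda>i. n - i) (relative_cohomology K V \<sigma> d))"
    by (rule pmod_iso_trans[OF A(2) persistent_homology_iso E])
  have "has_barcode K ?J (backward ?J) (relative_cohomology K V \<sigma> d)
      (image_mset (\<lambda>(a, b). (n - b, n - a)) M)"
    if M: "has_barcode K ?I (forward ?I) (A n (perp n D)) M" for M
    unfolding has_barcode_def
  proof
    \<comment> \<open>The bounds keep the subtractions exact, and a lower end of at least 1 places
      the reflected upper end \<open>n - a\<close> below \<open>n\<close>.\<close>
    have M_bounds: "\<forall>(a, b)\<in>set_mset M. 1 \<le> a \<and> a \<le> b \<and> b \<le> n"
      using M by (fastforce simp: has_barcode_def)
    then show "\<forall>(a, b)\<in>set_mset (image_mset (\<lambda>(a, b). (n - b, n - a)) M). a \<le> b \<and> {a..b} \<subseteq> ?J"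
      by fastforce
    \<comment> \<open>The inversion is applied to the output of the algorithm, which is known to be
      a persistence module by \<open>A(1)\<close>.\<close>
    have "pmod_iso K ?I (forward ?I) (reindex (\<lambda>i. n - i) (relative_cohomology K V \<sigma> d)) (interval_sum K M)"
      using M unfolding has_barcode_def
      by (intro pmod_iso_trans[OF pmod_iso_sym[OF A(1) iso E] _ E]) blast
    \<comment> \<open>The reversal maps \<open>?J\<close> into \<open>?I\<close> and is undone by
      itself; a step down in \<open>?J\<close> becomes a step up in \<open>?I\<close>.\<close>
    then have "pmod_iso K ?J (backward ?J) (relative_cohomology K V \<sigma> d)
        (reindex (\<lambda>i. n - i) (interval_sum K M))"
      by (rule pmod_iso_reindex) (auto simp: forward_def backward_def)
    then show "pmod_iso K ?J (backward ?J) (relative_cohomology K V \<sigma> d)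
        (interval_sum K (image_mset (\<lambda>(a, b). (n - b, n - a)) M))"
      by (rule pmod_iso_trans[OF _ pmod_iso_interval_sum_reverse[OF R.ring_axioms M_bounds F] F])
  qed
  then show ?thesis using dual_formal_cells iso by blast
qed

end
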